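(* Let $S$ be a finite Boolean inverse monoid. Then there are finite groups $G_{1},\ldots,G_{r}$ and natural numbers $n_{1},\ldots,n_{r}$ such that $$S\cong M_{n_{1}}(G_{1}^{0})\times\cdots\times M_{n_{r}}(G_{r}^{0}).$$
   Context: For an inverse semigroup $S$, $\mathsf{E}(S)$ is its set of idempotents. The natural partial order is $a\le b$ iff $a=ba^{-1}a$; joins and meets refer to it. Elements $a,b$ are compatible, $a\sim b$, if $a^{-1}b$ and $ab^{-1}$ are both idempotents; when $S$ has a zero they are orthogonal, $a\perp b$, if $a^{-1}b=0=ab^{-1}$. A Boolean algebra here means a generalized Boolean algebra: a distributive lattice with bottom (a top is not required) in which every principal order-ideal is a (unital) Boolean algebra. An inverse semigroup with zero is distributive if any two compatible elements have a join and multiplication distributes on both sides over such joins; it is Boolean if in addition $(\mathsf{E}(S),\le)$ is a Boolean algebra. A Boolean inverse monoid is a Boolean inverse semigroup with identity. Boolean inverse semigroups are assumed not to be the zero semigroup $\{0\}$. An orthogonal join (join of pairwise orthogonal elements) is written $\oplus$. For a group $G$, $G^{0}$ is $G$ with a zero adjoined; it is a Boolean inverse monoid. For a Boolean inverse semigroup $S$ and $n\ge 1$, $M_{n}(S)$ is the set of $n\times n$ rook matrices over $S$: matrices with entries in $S$ such that if $a,b$ lie in the same row and distinct columns then $a^{-1}b=0$, and if $a,b$ lie in the same column and distinct rows then $ab^{-1}=0$. Multiplication is $(AB)_{ij}=\bigoplus_{k}a_{ik}b_{kj}$; this makes $M_n(S)$ a Boolean inverse semigroup. (So an element of $M_n(G^0)$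 is a matrix over $G^0$ with at most one non-zero entry in each row and each column.) *)

theory Defs
  imports "HOL-Algebra.Product_Groups" "HOL-Algebra.Complete_Lattice" "Jordan_Normal_Form.Matrix"
begin

text \<open>
  Semigroups are represented by the record type of \<^theory>\<open>HOL-Algebra.Group\<close>; unless the
  locale \<^locale>\<open>monoid\<close> is assumed as well, the field \<^const>\<open>one\<close> is never referred to.
\<close>

section \<open>Boolean algebras as order structures\<close>

locale unital_boolean_algebra = bounded_lattice L for L (structure) +
  assumes meet_join_distrib:
    "\<lbrakk>x \<in> carrier L; y \<in> carrier L; z \<in> carrier L\<rbrakk>
      \<Longrightarrow> x \<sqinter> (y \<squnion> z) = (x \<sqinter> y) \<squnion> (x \<sqinter> z)"
    and complement_exists:
    "x \<in> carrier L \<Longrightarrow> \<exists>y\<in>carrier L. x \<sqinter> y = \<bottom> \<and> x \<squnion> y = \<top>"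

definition principal_order_ideal :: "('a, 'b) gorder_scheme \<Rightarrow> 'a \<Rightarrow> 'a set" where
  "principal_order_ideal L x = {y \<in> carrier L. y \<sqsubseteq>\<^bsub>L\<^esub> x}"

text \<open>No top element is required here.\<close>

locale generalized_boolean_algebra =
  Lattice.lattice L + weak_partial_order_bottom L for L (structure) +
  assumes meet_join_distrib:
    "\<lbrakk>x \<in> carrier L; y \<in> carrier L; z \<in> carrier L\<rbrakk>
      \<Longrightarrow> x \<sqinter> (y \<squnion> z) = (x \<sqinter> y) \<squnion> (x \<sqinter> z)"
    and principal_ideal_boolean:
    "x \<in> carrier L \<Longrightarrow> unital_boolean_algebra (L\<lparr>carrier := principal_order_ideal L x\<rparr>)"

section \<open>Inverse semigroups\<close>

locale inverse_semigroup =
  fixes S (structure)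
  assumes m_closed: "\<lbrakk>x \<in> carrier S; y \<in> carrier S\<rbrakk> \<Longrightarrow> x \<otimes> y \<in> carrier S"
    and m_assoc: "\<lbrakk>x \<in> carrier S; y \<in> carrier S; z \<in> carrier S\<rbrakk>
      \<Longrightarrow> (x \<otimes> y) \<otimes> z = x \<otimes> (y \<otimes> z)"
    and unique_inverse:
      "a \<in> carrier S \<Longrightarrow> \<exists>!b. b \<in> carrier S \<and> a \<otimes> b \<otimes> a = a \<and> b \<otimes> a \<otimes> b = b"

text \<open>This is the inverse of inverse semigroup theory, not the group-like inverse \<^const>\<open>m_inv\<close>.\<close>

definition sg_inv :: "('a, 'b) monoid_scheme \<Rightarrow> 'a \<Rightarrow> 'a" where
  "sg_inv S a = (THE b. b \<in> carrier S \<and> a \<otimes>\<^bsub>S\<^esub> b \<otimes>\<^bsub>S\<^esub> a = a \<and> b \<otimes>\<^bsub>S\<^esub> a \<otimes>\<^bsub>S\<^esub> b = b)"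

definition idempotents :: "('a, 'b) monoid_scheme \<Rightarrow> 'a set" where
  "idempotents S = {e \<in> carrier S. e \<otimes>\<^bsub>S\<^esub> e = e}"

definition natural_order :: "('a, 'b) monoid_scheme \<Rightarrow> 'a gorder" where
  "natural_order S = \<lparr>carrier = carrier S, eq = (=),
     le = (\<lambda>a b. a = b \<otimes>\<^bsub>S\<^esub> sg_inv S a \<otimes>\<^bsub>S\<^esub> a)\<rparr>"

definition idempotent_order :: "('a, 'b) monoid_scheme \<Rightarrow> 'a gorder" where
  "idempotent_order S = (natural_order S)\<lparr>carrier := idempotents S\<rparr>"

definition compatible :: "('a, 'b) monoid_scheme \<Rightarrow> 'a \<Rightarrow> 'a \<Rightarrow> bool" where
  "compatible S a b \<longleftrightarrow>
     sg_inv S a \<otimes>\<^bsub>S\<^esub> b \<in> idempotents S \<and> a \<otimes>\<^bsub>S\<^esub> sg_inv S b \<in> idempotents S"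

definition is_sg_zero :: "('a, 'b) monoid_scheme \<Rightarrow> 'a \<Rightarrow> bool" where
  "is_sg_zero S z \<longleftrightarrow>
     z \<in> carrier S \<and> (\<forall>x\<in>carrier S. z \<otimes>\<^bsub>S\<^esub> x = z \<and> x \<otimes>\<^bsub>S\<^esub> z = z)"

definition sg_zero :: "('a, 'b) monoid_scheme \<Rightarrow> 'a" where
  "sg_zero S = (THE z. is_sg_zero S z)"

locale distributive_inverse_semigroup = inverse_semigroup S for S (structure) +
  assumes zero_exists: "\<exists>z. is_sg_zero S z"
    and compatible_join_exists:
      "\<lbrakk>a \<in> carrier S; b \<in> carrier S; compatible S a b\<rbrakk>
        \<Longrightarrow> \<exists>j. is_lub (natural_order S) j {a, b}"
    and l_distrib:
      "\<lbrakk>a \<in> carrier S; b \<in> carrier S; c \<in> carrier S; compatible S a b\<rbrakk>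
        \<Longrightarrow> c \<otimes> (a \<squnion>\<^bsub>natural_order S\<^esub> b) = (c \<otimes> a) \<squnion>\<^bsub>natural_order S\<^esub> (c \<otimes> b)"
    and r_distrib:
      "\<lbrakk>a \<in> carrier S; b \<in> carrier S; c \<in> carrier S; compatible S a b\<rbrakk>
        \<Longrightarrow> (a \<squnion>\<^bsub>natural_order S\<^esub> b) \<otimes> c = (a \<otimes> c) \<squnion>\<^bsub>natural_order S\<^esub> (b \<otimes> c)"

locale boolean_inverse_semigroup = distributive_inverse_semigroup S for S (structure) +
  assumes idempotents_boolean: "generalized_boolean_algebra (idempotent_order S)"
    and not_zero_semigroup: "carrier S \<noteq> {sg_zero S}"

locale boolean_inverse_monoid = boolean_inverse_semigroup S + monoid S for S (structure)

section \<open>Groups with zero and rook matrices\<close>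

text \<open>\<^const>\<open>None\<close> is the adjoined zero.\<close>

definition adjoin_zero :: "('a, 'b) monoid_scheme \<Rightarrow> 'a option monoid" where
  "adjoin_zero G = \<lparr>carrier = insert None (Some ` carrier G),
     monoid.mult = (\<lambda>x y. case (x, y) of (Some g, Some h) \<Rightarrow> Some (g \<otimes>\<^bsub>G\<^esub> h) | _ \<Rightarrow> None),
     one = Some \<one>\<^bsub>G\<^esub>\<rparr>"

text \<open>Rows and columns are indexed by \<open>0, \<dots>, n - 1\<close>.\<close>

definition rook_matrices :: "nat \<Rightarrow> ('a, 'b) monoid_scheme \<Rightarrow> 'a mat set" where
  "rook_matrices n S = {A \<in> carrier_mat n n.
     (\<forall>i<n. \<forall>j<n. A $$ (i, j) \<in> carrier S) \<and>
     (\<forall>i<n. \<forall>j<n. \<forall>k<n. j \<noteq> k \<longrightarrow>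
        sg_inv S (A $$ (i, j)) \<otimes>\<^bsub>S\<^esub> A $$ (i, k) = sg_zero S) \<and>
     (\<forall>i<n. \<forall>j<n. \<forall>k<n. i \<noteq> k \<longrightarrow>
        A $$ (i, j) \<otimes>\<^bsub>S\<^esub> sg_inv S (A $$ (k, j)) = sg_zero S)}"

text \<open>
  The elements \<open>a\<^sub>i\<^sub>k b\<^sub>k\<^sub>j\<close> (\<open>k < n\<close>) are pairwise orthogonal for rook matrices, so the join below
  is the orthogonal join. The field \<^const>\<open>one\<close> is the identity matrix; it is meaningful only if
  \<open>S\<close> is a monoid.
\<close>

definition rook_matrix_semigroup :: "nat \<Rightarrow> ('a, 'b) monoid_scheme \<Rightarrow> 'a mat monoid" where
  "rook_matrix_semigroup n S = \<lparr>carrier = rook_matrices n S,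
     monoid.mult = (\<lambda>A B. mat n n (\<lambda>(i, j).
       \<Squnion>\<^bsub>natural_order S\<^esub> ((\<lambda>k. A $$ (i, k) \<otimes>\<^bsub>S\<^esub> B $$ (k, j)) ` {..<n}))),
     one = mat n n (\<lambda>(i, j). if i = j then \<one>\<^bsub>S\<^esub> else sg_zero S)\<rparr>"

end

theory Submission
  imports Defs
begin

text \<open>Think of \<open>S\<close> as partial bijections: an element \<open>a\<close> goes from the idempotent \<open>a\<dagger>a\<close> to the
  idempotent \<open>aa\<dagger>\<close>. If \<open>S\<close> is finite, the Boolean algebra of idempotents is generated by its atoms,
  and the product \<open>af\<close> of an element with an atom is either zero or goes from \<open>f\<close> to exactly one
  atom (\<open>ran_atom\<close>). The nonzero elements with atomic domain thus form a finite groupoid with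
  the atoms as objects. A connected finite groupoid with \<open>n\<close> objects is determined by \<open>n\<close> and the
  group at one of its objects, and an element of \<open>S\<close> is the same thing as a set of arrows with
  pairwise distinct sources and pairwise distinct targets. On one connected component such a set is
  a rook matrix over the group with zero, whence one factor for each component.

  To make this explicit, choose in each component \<open>i\<close> a base atom \<open>e i\<close> and for each of its
  atoms an arrow \<open>x i j\<close> from \<open>e i\<close> to that atom. The coordinates of \<open>a\<close> are
  \<open>(x i j)\<dagger> a (x i k)\<close>, which are zero or lie in the group at \<open>e i\<close>. They are multiplicative because
  an arrow \<open>b (x i k)\<close> ends at a single atom of the component, so that only one term contributes to
  an entry of the product (\<open>entry_mult\<close>). They are injective because the elements are separated
  by their products with atoms (\<open>eq_on_idempotents_if_eq_on_atoms\<close>), which is where relative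
  complements of idempotents and distributivity enter. They are surjective because the arrows read
  off from rook matrices are pairwise orthogonal and therefore have a join whose products
  with the arrows \<open>x i j\<close> can be calculated one arrow at a time (\<open>orthogonal_sum\<close>).\<close>

section \<open>Inverse semigroups\<close>

context inverse_semigroup
begin

abbreviation dagger :: "'a \<Rightarrow> 'a" ("_\<dagger>" [1000] 999) where
  "a\<dagger> \<equiv> sg_inv S a"

abbreviation E :: "'a set" where
  "E \<equiv> idempotents S"

lemma dagger_props:
  assumes "a \<in> carrier S"
  shows "a\<dagger> \<in> carrier S \<and> a \<otimes> a\<dagger> \<otimes> a = a \<and> a\<dagger> \<otimes> a \<otimes> a\<dagger> = a\<dagger>"
  unfolding sg_inv_def by (rule theI'[OF unique_inverse[OF assms]])

lemma dagger_closed [simp]: "a \<in> carrier S \<Longrightarrow> a\<dagger> \<in> carrier S"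
  using dagger_props by blast

lemma mult_dagger_mult: "a \<in> carrier S \<Longrightarrow> a \<otimes> (a\<dagger> \<otimes> a) = a"
  using dagger_props[of a] m_assoc[of a "a\<dagger>" a] by simp

lemma dagger_mult_dagger: "a \<in> carrier S \<Longrightarrow> a\<dagger> \<otimes> (a \<otimes> a\<dagger>) = a\<dagger>"
  using dagger_props[of a] m_assoc[of "a\<dagger>" a "a\<dagger>"] by simp

lemma mult_dagger_mult_left:
  "\<lbrakk>a \<in> carrier S; z \<in> carrier S\<rbrakk> \<Longrightarrow> a \<otimes> (a\<dagger> \<otimes> (a \<otimes> z)) = a \<otimes> z"
  by (metis dagger_closed dagger_props m_assoc m_closed)

lemma dagger_mult_dagger_left:
  "\<lbrakk>a \<in> carrier S; z \<in> carrier S\<rbrakk> \<Longrightarrow> a\<dagger> \<otimes> (a \<otimes> (a\<dagger> \<otimes> z)) = a\<dagger> \<otimes> z"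
  by (metis dagger_closed dagger_props m_assoc m_closed)

lemmas inv_simps = m_closed m_assoc mult_dagger_mult dagger_mult_dagger
  mult_dagger_mult_left dagger_mult_dagger_left

lemma dagger_eqI:
  assumes "a \<in> carrier S" "b \<in> carrier S" "a \<otimes> (b \<otimes> a) = a" "b \<otimes> (a \<otimes> b) = b"
  shows "a\<dagger> = b"
  using unique_inverse[OF assms(1)] dagger_props[OF assms(1)] assms
  by (metis m_assoc)

lemma dagger_dagger [simp]: "a \<in> carrier S \<Longrightarrow> (a\<dagger>)\<dagger> = a"
  by (rule dagger_eqI) (simp_all add: inv_simps)

lemma idemD: "e \<in> E \<Longrightarrow> e \<in> carrier S \<and> e \<otimes> e = e"
  by (simp add: idempotents_def)

lemma idem_closed [simp]: "e \<in> E \<Longrightarrow> e \<in> carrier S"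
  using idemD by blast

lemma idem_idem [simp]: "e \<in> E \<Longrightarrow> e \<otimes> e = e"
  using idemD by blast

lemma idem_idem_left: "\<lbrakk>e \<in> E; z \<in> carrier S\<rbrakk> \<Longrightarrow> e \<otimes> (e \<otimes> z) = e \<otimes> z"
  by (metis idemD m_assoc)

lemma idem_dagger [simp]: "e \<in> E \<Longrightarrow> e\<dagger> = e"
  by (rule dagger_eqI) simp_all

lemma idemI: "\<lbrakk>e \<in> carrier S; e \<otimes> e = e\<rbrakk> \<Longrightarrow> e \<in> E"
  unfolding idempotents_def by blast

text \<open>The inverse \<open>x\<close> of a product \<open>ef\<close> of idempotents absorbs \<open>f\<close> on the left and \<open>e\<close> on the
  right, because \<open>fxe\<close> is an inverse of \<open>ef\<close> too. This makes \<open>x\<close> idempotent, hence its own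
  inverse, and so \<open>ef = x\<close>.\<close>

lemma idem_mult_closed:
  assumes e: "e \<in> E" and f: "f \<in> E"
  shows "e \<otimes> f \<in> E"
proof -
  define x where "x = (e \<otimes> f)\<dagger>"
  have ef: "e \<otimes> f \<in> carrier S" and x: "x \<in> carrier S"
    using e f by (simp_all add: m_closed x_def)
  have 1: "e \<otimes> (f \<otimes> (x \<otimes> (e \<otimes> f))) = e \<otimes> f"
    using mult_dagger_mult[OF ef] e f x by (simp add: x_def[symmetric] m_assoc m_closed)
  have 2: "x \<otimes> (e \<otimes> (f \<otimes> x)) = x"
    using dagger_mult_dagger[OF ef] e f x by (simp add: x_def[symmetric] m_assoc m_closed)
  have 3: "x \<otimes> (e \<otimes> (f \<otimes> (x \<otimes> z))) = x \<otimes> z" if "z \<in> carrier S" for z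
    using arg_cong[OF 2, of "\<lambda>u. u \<otimes> z"] e f x that by (simp add: m_assoc m_closed)
  have "(e \<otimes> f)\<dagger> = f \<otimes> (x \<otimes> e)"
    by (rule dagger_eqI)
      (use e f x in \<open>simp_all add: m_closed m_assoc idem_idem_left 1 3\<close>)
  then have "x = f \<otimes> (x \<otimes> e)" by (simp add: x_def)
  moreover have "(f \<otimes> (x \<otimes> e)) \<otimes> (f \<otimes> (x \<otimes> e)) = f \<otimes> (x \<otimes> e)"
    using e f x by (simp add: m_closed m_assoc 3)
  ultimately have xE: "x \<in> E" using x by (intro idemI) simp_all
  have "e \<otimes> f = x"
    using dagger_dagger[OF ef] xE by (simp add: x_def[symmetric])
  with xE show ?thesis by simp
qed

text \<open>The products \<open>ef\<close> and \<open>fe\<close> are idempotent, so \<open>ef\<close> is its own inverse; but \<open>fe\<close> is an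
  inverse of \<open>ef\<close> as well, and inverses are unique.\<close>

lemma idem_commute:
  assumes e: "e \<in> E" and f: "f \<in> E"
  shows "e \<otimes> f = f \<otimes> e"
proof -
  have ef: "e \<otimes> f \<in> E" and fe: "f \<otimes> e \<in> E"
    using e f by (simp_all add: idem_mult_closed)
  have a: "e \<otimes> (f \<otimes> (e \<otimes> f)) = e \<otimes> f" "f \<otimes> (e \<otimes> (f \<otimes> e)) = f \<otimes> e"
    using idem_idem[OF ef] idem_idem[OF fe] e f by (simp_all add: m_assoc m_closed)
  have "(e \<otimes> f)\<dagger> = f \<otimes> e"
    by (rule dagger_eqI) (use e f in \<open>simp_all add: m_closed m_assoc idem_idem_left a\<close>)
  then show ?thesis using idem_dagger[OF ef] by metis
qed

lemma dom_idem: "a \<in> carrier S \<Longrightarrow> a\<dagger> \<otimes> a \<in> E"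
  by (rule idemI) (simp_all add: inv_simps)

lemma ran_idem: "a \<in> carrier S \<Longrightarrow> a \<otimes> a\<dagger> \<in> E"
  by (rule idemI) (simp_all add: inv_simps)

lemma dagger_mult:
  assumes a: "a \<in> carrier S" and b: "b \<in> carrier S"
  shows "(a \<otimes> b)\<dagger> = b\<dagger> \<otimes> a\<dagger>"
proof (rule dagger_eqI)
  have c: "b \<otimes> (b\<dagger> \<otimes> (a\<dagger> \<otimes> (a \<otimes> z))) = a\<dagger> \<otimes> (a \<otimes> (b \<otimes> (b\<dagger> \<otimes> z)))"
    if "z \<in> carrier S" for z
    using arg_cong[OF idem_commute[OF ran_idem[OF b] dom_idem[OF a]], of "\<lambda>u. u \<otimes> z"] a b that
    by (simp add: m_assoc m_closed)
  show "(a \<otimes> b) \<otimes> ((b\<dagger> \<otimes> a\<dagger>) \<otimes> (a \<otimes> b)) = a \<otimes> b"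
    using a b by (simp add: inv_simps c)
  show "(b\<dagger> \<otimes> a\<dagger>) \<otimes> ((a \<otimes> b) \<otimes> (b\<dagger> \<otimes> a\<dagger>)) = b\<dagger> \<otimes> a\<dagger>"
    using a b c[of "a\<dagger>", symmetric] by (simp add: inv_simps)
qed (use a b in \<open>simp_all add: m_closed\<close>)

lemma conj_idem:
  assumes a: "a \<in> carrier S" and e: "e \<in> E"
  shows "a \<otimes> (e \<otimes> a\<dagger>) \<in> E"
proof (rule idemI)
  have c: "e \<otimes> (a\<dagger> \<otimes> (a \<otimes> z)) = a\<dagger> \<otimes> (a \<otimes> (e \<otimes> z))" if "z \<in> carrier S" for z
    using arg_cong[OF idem_commute[OF e dom_idem[OF a]], of "\<lambda>u. u \<otimes> z"] a e that
    by (simp add: m_assoc m_closed)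
  show "a \<otimes> (e \<otimes> a\<dagger>) \<otimes> (a \<otimes> (e \<otimes> a\<dagger>)) = a \<otimes> (e \<otimes> a\<dagger>)"
    using a e by (simp add: inv_simps c idem_idem_left)
qed (use a e in \<open>simp add: m_closed\<close>)

lemma conj_idem': "\<lbrakk>a \<in> carrier S; e \<in> E\<rbrakk> \<Longrightarrow> a\<dagger> \<otimes> (e \<otimes> a) \<in> E"
  using conj_idem[of "a\<dagger>" e] by simp

lemma natural_order_le:
  "a \<sqsubseteq>\<^bsub>natural_order S\<^esub> b \<longleftrightarrow> a = b \<otimes> a\<dagger> \<otimes> a"
  by (simp add: natural_order_def)

lemma natural_order_carrier [simp]: "carrier (natural_order S) = carrier S"
  by (simp add: natural_order_def)

lemma natural_order_eq [simp]: "eq (natural_order S) = (=)"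
  by (simp add: natural_order_def)

text \<open>If \<open>a\<close> is below \<open>b\<close>, then \<open>a = bp\<close> with \<open>p = a\<dagger>a\<close>, and commuting \<open>p\<close> past \<open>b\<dagger>b\<close> shows that
  \<open>b\<dagger>b\<close> is a right identity for \<open>a\<close>. Antisymmetry and transitivity of the natural order rest on
  this.\<close>

lemma le_imp_absorb:
  assumes "a \<in> carrier S" "b \<in> carrier S" "a = b \<otimes> a\<dagger> \<otimes> a"
  shows "a \<otimes> (b\<dagger> \<otimes> b) = a" and "(a\<dagger> \<otimes> a) \<otimes> (b\<dagger> \<otimes> b) = a\<dagger> \<otimes> a"
proof -
  have eq: "a = b \<otimes> (a\<dagger> \<otimes> a)"
    using assms by (simp add: m_assoc)
  have "a \<otimes> (b\<dagger> \<otimes> b) = (b \<otimes> (a\<dagger> \<otimes> a)) \<otimes> (b\<dagger> \<otimes> b)"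
    using eq by simp
  also have "\<dots> = b \<otimes> ((a\<dagger> \<otimes> a) \<otimes> (b\<dagger> \<otimes> b))"
    using assms(1,2) by (simp add: m_assoc m_closed)
  also have "\<dots> = b \<otimes> ((b\<dagger> \<otimes> b) \<otimes> (a\<dagger> \<otimes> a))"
    using idem_commute[OF dom_idem[OF assms(1)] dom_idem[OF assms(2)]] by simp
  also have "\<dots> = b \<otimes> (a\<dagger> \<otimes> a)"
    using assms(1,2) by (simp add: inv_simps)
  finally show *: "a \<otimes> (b\<dagger> \<otimes> b) = a" using eq by simp
  show "(a\<dagger> \<otimes> a) \<otimes> (b\<dagger> \<otimes> b) = a\<dagger> \<otimes> a"
    using * assms(1,2) by (simp add: m_assoc m_closed)
qed

lemma natural_order_partial_order: "partial_order (natural_order S)"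
proof
  fix a b c
  show "a \<in> carrier (natural_order S) \<Longrightarrow> a \<sqsubseteq>\<^bsub>natural_order S\<^esub> a"
    by (simp add: natural_order_le inv_simps)
  assume ab: "a \<sqsubseteq>\<^bsub>natural_order S\<^esub> b"
    and a: "a \<in> carrier (natural_order S)" and b: "b \<in> carrier (natural_order S)"
  have ab': "a = b \<otimes> a\<dagger> \<otimes> a" and ca: "a \<in> carrier S" and cb: "b \<in> carrier S"
    using ab a b by (simp_all add: natural_order_le)
  { assume "b \<sqsubseteq>\<^bsub>natural_order S\<^esub> a"
    then have "b = a \<otimes> (b\<dagger> \<otimes> b)"
      using ca cb by (simp add: natural_order_le m_assoc)
    then show "a .=\<^bsub>natural_order S\<^esub> b"
      using le_imp_absorb(1)[OF ca cb ab'] by simp }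
  { assume bc: "b \<sqsubseteq>\<^bsub>natural_order S\<^esub> c" and c: "c \<in> carrier (natural_order S)"
    have "a = b \<otimes> (a\<dagger> \<otimes> a)"
      using ab' ca cb by (simp add: m_assoc)
    also have "\<dots> = (c \<otimes> (b\<dagger> \<otimes> b)) \<otimes> (a\<dagger> \<otimes> a)"
      using bc ca cb c by (simp add: natural_order_le m_assoc)
    also have "\<dots> = c \<otimes> ((a\<dagger> \<otimes> a) \<otimes> (b\<dagger> \<otimes> b))"
      using idem_commute[OF dom_idem[OF ca] dom_idem[OF cb]] ca cb c by (simp add: m_assoc m_closed)
    also have "\<dots> = c \<otimes> a\<dagger> \<otimes> a"
      using le_imp_absorb(2)[OF ca cb ab'] ca cb c by (simp add: m_assoc)
    finally show "a \<sqsubseteq>\<^bsub>natural_order S\<^esub> c"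
      by (simp add: natural_order_le) }
qed auto

text \<open>The supremum operation is an arbitrary choice among the least upper bounds; antisymmetry of
  the natural order leaves only one candidate.\<close>

lemma sup_eqI:
  assumes "is_lub (natural_order S) j A"
  shows "\<Squnion>\<^bsub>natural_order S\<^esub> A = j"
proof -
  interpret partial_order "natural_order S" by (rule natural_order_partial_order)
  show ?thesis
    unfolding sup_def using assms by (intro some_equality) (auto intro: least_unique)
qed

lemma idem_le_iff:
  assumes "e \<in> E" "f \<in> E"
  shows "e \<sqsubseteq>\<^bsub>natural_order S\<^esub> f \<longleftrightarrow> f \<otimes> e = e"
  using assms by (auto simp: natural_order_le m_assoc)

lemma below_idem_is_idem:
  assumes "a \<in> carrier S" "e \<in> E" "a \<sqsubseteq>\<^bsub>natural_order S\<^esub> e"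
  shows "a \<in> E"
  using assms idem_mult_closed[OF assms(2) dom_idem[OF assms(1)]]
  by (simp add: natural_order_le m_assoc)

end

section \<open>Zero and orthogonal joins\<close>

context distributive_inverse_semigroup
begin

abbreviation zero :: 'a ("\<zero>\<^sub>S") where
  "\<zero>\<^sub>S \<equiv> sg_zero S"

lemma is_zero: "is_sg_zero S \<zero>\<^sub>S"
proof -
  obtain z where z: "is_sg_zero S z" using zero_exists by blast
  moreover have "w = z" if "is_sg_zero S w" for w
    using z that unfolding is_sg_zero_def by metis
  ultimately show ?thesis
    unfolding sg_zero_def by (rule theI)
qed

lemma zero_closed [simp]: "\<zero>\<^sub>S \<in> carrier S"
  and zero_left [simp]: "x \<in> carrier S \<Longrightarrow> \<zero>\<^sub>S \<otimes> x = \<zero>\<^sub>S"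
  and zero_right [simp]: "x \<in> carrier S \<Longrightarrow> x \<otimes> \<zero>\<^sub>S = \<zero>\<^sub>S"
  using is_zero by (auto simp: is_sg_zero_def)

lemma zero_idem [simp]: "\<zero>\<^sub>S \<in> E"
  by (rule idemI) simp_all

lemma dom_zero_imp_zero: "\<lbrakk>a \<in> carrier S; a\<dagger> \<otimes> a = \<zero>\<^sub>S\<rbrakk> \<Longrightarrow> a = \<zero>\<^sub>S"
  by (metis mult_dagger_mult zero_right)

lemma dagger_eq_zero_iff: "a \<in> carrier S \<Longrightarrow> a\<dagger> = \<zero>\<^sub>S \<longleftrightarrow> a = \<zero>\<^sub>S"
  by (metis dagger_dagger idem_dagger zero_idem)

lemma join_zero:
  assumes "a \<in> carrier S"
  shows "\<zero>\<^sub>S \<squnion>\<^bsub>natural_order S\<^esub> a = a" and "a \<squnion>\<^bsub>natural_order S\<^esub> \<zero>\<^sub>S = a"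
proof -
  interpret partial_order "natural_order S" by (rule natural_order_partial_order)
  have "is_lub (natural_order S) a {\<zero>\<^sub>S, a}"
    using assms by (intro least_UpperI) (auto simp: Upper_def natural_order_le inv_simps)
  then show "\<zero>\<^sub>S \<squnion>\<^bsub>natural_order S\<^esub> a = a" "a \<squnion>\<^bsub>natural_order S\<^esub> \<zero>\<^sub>S = a"
    using sup_eqI unfolding join_def by (simp_all add: insert_commute)
qed

definition orthogonal :: "'a \<Rightarrow> 'a \<Rightarrow> bool" where
  "orthogonal a b \<longleftrightarrow> a\<dagger> \<otimes> b = \<zero>\<^sub>S \<and> a \<otimes> b\<dagger> = \<zero>\<^sub>S"

lemma orthogonal_compatible: "orthogonal a b \<Longrightarrow> compatible S a b"
  by (simp add: orthogonal_def compatible_def)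

lemma orthogonal_mult_left:
  assumes "orthogonal a b" "a \<in> carrier S" "b \<in> carrier S" "c \<in> carrier S"
  shows "orthogonal (c \<otimes> a) (c \<otimes> b)"
proof -
  have 1: "a\<dagger> \<otimes> b = \<zero>\<^sub>S" "a \<otimes> b\<dagger> = \<zero>\<^sub>S"
    using assms by (simp_all add: orthogonal_def)
  have c: "a\<dagger> \<otimes> (c\<dagger> \<otimes> (c \<otimes> b)) = \<zero>\<^sub>S"
  proof -
    have com: "b \<otimes> b\<dagger> \<otimes> (c\<dagger> \<otimes> c) = c\<dagger> \<otimes> c \<otimes> (b \<otimes> b\<dagger>)"
      using assms by (intro idem_commute ran_idem dom_idem) auto
    have "a\<dagger> \<otimes> (c\<dagger> \<otimes> (c \<otimes> b)) = a\<dagger> \<otimes> ((c\<dagger> \<otimes> c \<otimes> (b \<otimes> b\<dagger>)) \<otimes> b)"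
      using assms by (simp add: inv_simps)
    also have "\<dots> = (a\<dagger> \<otimes> b) \<otimes> (b\<dagger> \<otimes> (c\<dagger> \<otimes> c) \<otimes> b)"
      using assms by (simp only: com[symmetric]) (simp add: inv_simps)
    finally show ?thesis using 1 assms by (simp add: m_closed)
  qed
  have "(c \<otimes> a) \<otimes> (c \<otimes> b)\<dagger> = c \<otimes> ((a \<otimes> b\<dagger>) \<otimes> c\<dagger>)"
    using assms by (simp add: dagger_mult inv_simps)
  then show ?thesis
    using c 1 assms by (simp add: orthogonal_def dagger_mult m_assoc m_closed)
qed

text \<open>Distributivity on the two sides has to be applied in succession. The second application needs
  that \<open>ca\<close> and \<open>cb\<close> are still compatible, which is why orthogonality is shown above to survive
  multiplication.\<close>

lemma mult_orthogonal_join: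
  assumes "orthogonal a b" "a \<in> carrier S" "b \<in> carrier S" "c \<in> carrier S" "d \<in> carrier S"
  shows "c \<otimes> ((a \<squnion>\<^bsub>natural_order S\<^esub> b) \<otimes> d)
    = (c \<otimes> (a \<otimes> d)) \<squnion>\<^bsub>natural_order S\<^esub> (c \<otimes> (b \<otimes> d))"
proof -
  obtain j where j: "is_lub (natural_order S) j {a, b}"
    using compatible_join_exists orthogonal_compatible assms by blast
  have jc: "j \<in> carrier S" and je: "a \<squnion>\<^bsub>natural_order S\<^esub> b = j"
    using j sup_eqI[OF j] by (auto simp: least_def Upper_def join_def)
  have "c \<otimes> (j \<otimes> d) = (c \<otimes> j) \<otimes> d"
    using assms jc by (simp add: m_assoc)
  also have "c \<otimes> j = (c \<otimes> a) \<squnion>\<^bsub>natural_order S\<^esub> (c \<otimes> b)"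
    using l_distrib[of a b c] assms orthogonal_compatible je by simp
  also have "\<dots> \<otimes> d = (c \<otimes> a \<otimes> d) \<squnion>\<^bsub>natural_order S\<^esub> (c \<otimes> b \<otimes> d)"
    using assms orthogonal_mult_left orthogonal_compatible by (intro r_distrib) (auto simp: m_closed)
  finally show ?thesis
    using assms je by (simp add: m_assoc)
qed

lemma orthogonal_join_closed:
  assumes "orthogonal a b" "a \<in> carrier S" "b \<in> carrier S"
  shows "a \<squnion>\<^bsub>natural_order S\<^esub> b \<in> carrier S"
proof -
  obtain j where j: "is_lub (natural_order S) j {a, b}"
    using compatible_join_exists orthogonal_compatible assms by blast
  then show ?thesis
    using sup_eqI[OF j] by (auto simp: least_def Upper_def join_def)
qed

end

section \<open>Atomic idempotents\<close>

context boolean_inverse_semigroup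
begin

text \<open>In the idempotent semilattice \<open>f\<close> lies below \<open>e\<close> exactly when \<open>ef = f\<close>, so these are the
  atoms of the Boolean algebra of idempotents.\<close>

definition atoms :: "'a set" where
  "atoms = {e \<in> E. e \<noteq> \<zero>\<^sub>S \<and> (\<forall>f\<in>E. e \<otimes> f = f \<longrightarrow> f = \<zero>\<^sub>S \<or> f = e)}"

lemma atomsD:
  assumes "e \<in> atoms"
  shows "e \<in> E" "e \<in> carrier S" "e \<noteq> \<zero>\<^sub>S"
    and "\<lbrakk>f \<in> E; e \<otimes> f = f\<rbrakk> \<Longrightarrow> f = \<zero>\<^sub>S \<or> f = e"
  using assms idemD by (auto simp: atoms_def)

lemma atoms_disjoint:
  assumes "e \<in> atoms" "f \<in> atoms" "e \<noteq> f"
  shows "e \<otimes> f = \<zero>\<^sub>S"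
proof -
  note e = atomsD[OF assms(1)] and f = atomsD[OF assms(2)]
  have ef: "e \<otimes> f \<in> E" using e f by (simp add: idem_mult_closed)
  have "e \<otimes> (e \<otimes> f) = e \<otimes> f" "f \<otimes> (e \<otimes> f) = e \<otimes> f"
    using e f idem_commute[OF e(1) f(1)] idem_idem_left[of e f] idem_idem_left[of f e]
    by simp_all
  then show ?thesis using e(4)[OF ef] f(4)[OF ef] assms(3) by auto
qed

lemma dom_eq_atom:
  assumes "y \<in> carrier S" "y \<noteq> \<zero>\<^sub>S" "e \<in> atoms" "y \<otimes> e = y"
  shows "y\<dagger> \<otimes> y = e"
proof -
  note e = atomsD[OF assms(3)]
  have "e \<otimes> (y\<dagger> \<otimes> y) = y\<dagger> \<otimes> y \<otimes> e"
    using idem_commute[OF e(1) dom_idem[OF assms(1)]] by simp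
  also have "\<dots> = y\<dagger> \<otimes> y"
    using assms e by (simp add: m_assoc)
  finally show ?thesis
    using e(4)[OF dom_idem[OF assms(1)]] dom_zero_imp_zero assms(1,2) by blast
qed

lemma ran_eq_atom:
  assumes "y \<in> carrier S" "y \<noteq> \<zero>\<^sub>S" "e \<in> atoms" "e \<otimes> y = y"
  shows "y \<otimes> y\<dagger> = e"
proof -
  note e = atomsD[OF assms(3)]
  have "y\<dagger> \<otimes> e = (e \<otimes> y)\<dagger>"
    using assms(1) e by (simp add: dagger_mult)
  then show ?thesis
    using dom_eq_atom[of "y\<dagger>" e] assms by (simp add: dagger_eq_zero_iff)
qed

text \<open>An element \<open>y\<close> transports idempotents below \<open>yy\<dagger>\<close> to idempotents below \<open>y\<dagger>y\<close> by
  conjugation, and the transport can be undone. Hence \<open>yy\<dagger>\<close> inherits from \<open>y\<dagger>y\<close> that nothing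
  lies strictly between it and zero.\<close>

lemma ran_atom:
  assumes y: "y \<in> carrier S" and dom: "y\<dagger> \<otimes> y \<in> atoms"
  shows "y \<otimes> y\<dagger> \<in> atoms"
  unfolding atoms_def
proof (intro CollectI conjI ballI impI)
  show "y \<otimes> y\<dagger> \<in> E" by (rule ran_idem[OF y])
  show "y \<otimes> y\<dagger> \<noteq> \<zero>\<^sub>S"
  proof
    assume "y \<otimes> y\<dagger> = \<zero>\<^sub>S"
    then have "y\<dagger> = \<zero>\<^sub>S" using dom_zero_imp_zero[of "y\<dagger>"] y by simp
    then have "y\<dagger> \<otimes> y = \<zero>\<^sub>S" using y by simp
    then show False using atomsD(3)[OF dom] by simp
  qed
  fix f assume f: "f \<in> E" and "y \<otimes> y\<dagger> \<otimes> f = f"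
  then have yf: "y \<otimes> (y\<dagger> \<otimes> f) = f"
    using y by (simp add: m_assoc)
  moreover have "y \<otimes> y\<dagger> \<otimes> f = f \<otimes> (y \<otimes> y\<dagger>)"
    by (rule idem_commute[OF ran_idem[OF y] f])
  ultimately have fy: "f \<otimes> (y \<otimes> y\<dagger>) = f"
    using y f by (simp add: m_assoc)
  have conj: "y \<otimes> (y\<dagger> \<otimes> (f \<otimes> y)) \<otimes> y\<dagger> = f"
  proof -
    have "y \<otimes> (y\<dagger> \<otimes> (f \<otimes> y)) \<otimes> y\<dagger> = (y \<otimes> (y\<dagger> \<otimes> f)) \<otimes> (y \<otimes> y\<dagger>)"
      using y f by (simp add: m_assoc m_closed)
    then show ?thesis using yf fy by simp
  qed
  have "y\<dagger> \<otimes> (f \<otimes> y) = \<zero>\<^sub>S \<or> y\<dagger> \<otimes> (f \<otimes> y) = y\<dagger> \<otimes> y"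
    using y f by (intro atomsD(4)[OF dom]) (simp_all add: conj_idem' inv_simps)
  then show "f = \<zero>\<^sub>S \<or> f = y \<otimes> y\<dagger>"
  proof
    assume "y\<dagger> \<otimes> (f \<otimes> y) = \<zero>\<^sub>S"
    then show ?thesis using conj y by simp
  next
    assume "y\<dagger> \<otimes> (f \<otimes> y) = y\<dagger> \<otimes> y"
    then show ?thesis using conj y by (simp add: inv_simps)
  qed
qed

lemma dom_atom:
  assumes "y \<in> carrier S" "y \<otimes> y\<dagger> \<in> atoms"
  shows "y\<dagger> \<otimes> y \<in> atoms"
  using ran_atom[of "y\<dagger>"] assms by simp

text \<open>The complement \<open>g\<close> of \<open>f\<close> in the ideal below \<open>e\<close> is provided by the Boolean algebra of
  idempotents, and there \<open>e\<close> is the join of \<open>f\<close> and \<open>g\<close>. Multiplication distributes over joins taken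
  in \<open>S\<close>, though. Both joins agree because the join \<open>j\<close> in \<open>S\<close> lies below \<open>e\<close>, so that it is itself
  an idempotent of the ideal.\<close>

lemma relative_complement:
  assumes e: "e \<in> E" and f: "f \<in> E" and ef: "e \<otimes> f = f" and f0: "f \<noteq> \<zero>\<^sub>S"
  obtains g where "g \<in> E" "e \<otimes> g = g" "g \<noteq> e" "e = f \<squnion>\<^bsub>natural_order S\<^esub> g"
proof -
  let ?L = "(idempotent_order S)\<lparr>carrier := principal_order_ideal (idempotent_order S) e\<rparr>"
  interpret O: partial_order "natural_order S" by (rule natural_order_partial_order)
  have leL: "x \<sqsubseteq>\<^bsub>idempotent_order S\<^esub> y \<longleftrightarrow> x \<sqsubseteq>\<^bsub>natural_order S\<^esub> y" for x y
    by (simp add: idempotent_order_def)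
  have carL: "carrier ?L = {g \<in> E. g \<sqsubseteq>\<^bsub>natural_order S\<^esub> e}"
    by (simp add: principal_order_ideal_def idempotent_order_def)
  interpret G: generalized_boolean_algebra "idempotent_order S"
    by (rule idempotents_boolean)
  interpret L: unital_boolean_algebra ?L
    by (rule G.principal_ideal_boolean) (simp add: idempotent_order_def e)
  have fL: "f \<in> carrier ?L" and eL: "e \<in> carrier ?L" and zL: "\<zero>\<^sub>S \<in> carrier ?L"
    unfolding carL using e f ef by (simp_all add: idem_le_iff)
  obtain g where gL: "g \<in> carrier ?L" and meet: "f \<sqinter>\<^bsub>?L\<^esub> g = \<bottom>\<^bsub>?L\<^esub>"
    and join: "f \<squnion>\<^bsub>?L\<^esub> g = \<top>\<^bsub>?L\<^esub>"
    using L.complement_exists[OF fL] by blast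
  have gE: "g \<in> E" and eg: "e \<otimes> g = g"
    using gL e unfolding carL by (auto simp: idem_le_iff)
  have "g \<noteq> e"
  proof
    assume "g = e"
    have "f \<sqsubseteq>\<^bsub>?L\<^esub> f \<sqinter>\<^bsub>?L\<^esub> g"
      using fL gL \<open>g = e\<close> e f ef by (intro L.meet_le) (simp_all add: leL idem_le_iff)
    also have "\<dots> \<sqsubseteq>\<^bsub>?L\<^esub> \<zero>\<^sub>S"
      unfolding meet using zL by (rule L.bottom_lower)
    finally have "f \<sqsubseteq>\<^bsub>natural_order S\<^esub> \<zero>\<^sub>S"
      using fL gL zL L.meet_closed[OF fL gL] by (simp add: leL)
    then have "\<zero>\<^sub>S \<otimes> f = f" using idem_le_iff[OF f zero_idem] by simp
    then show False using f0 f by simp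
  qed
  have cg: "compatible S f g"
    using f gE by (simp add: compatible_def idem_mult_closed)
  obtain j where j: "is_lub (natural_order S) j {f, g}"
    using compatible_join_exists[OF idem_closed[OF f] idem_closed[OF gE] cg] by blast
  have jS: "j \<in> carrier S"
    using j by (simp add: least_def Upper_def)
  have je: "j \<sqsubseteq>\<^bsub>natural_order S\<^esub> e"
    using fL gL e j unfolding carL least_def by (auto simp: Upper_def)
  have fj: "f \<sqsubseteq>\<^bsub>natural_order S\<^esub> j" and gj: "g \<sqsubseteq>\<^bsub>natural_order S\<^esub> j"
    using j f gE by (auto simp: least_def Upper_def)
  have jL: "j \<in> carrier ?L"
    unfolding carL using je below_idem_is_idem[OF jS e je] by simp
  have "e \<sqsubseteq>\<^bsub>?L\<^esub> f \<squnion>\<^bsub>?L\<^esub> g"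
    unfolding join using eL by (rule L.top_higher)
  also have "\<dots> \<sqsubseteq>\<^bsub>?L\<^esub> j"
    using fL gL jL fj gj by (intro L.join_le) (simp_all add: leL)
  finally have "e \<sqsubseteq>\<^bsub>natural_order S\<^esub> j"
    using eL fL gL jL L.join_closed[OF fL gL] by (simp add: leL)
  then have "j = e"
    using je O.le_antisym jS e by simp
  then have "e = f \<squnion>\<^bsub>natural_order S\<^esub> g"
    using sup_eqI[OF j] by (simp add: join_def)
  with gE eg \<open>g \<noteq> e\<close> show thesis by (rule that)
qed

text \<open>A nonzero idempotent that is not an atom is the join of two strictly smaller idempotents, so
  agreement spreads from the atoms upwards by distributivity. For \<open>e = 1\<close> this says that the atoms
  separate the elements of a finite monoid.\<close>

lemma eq_on_idempotents_if_eq_on_atoms: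
  assumes fin: "finite (carrier S)"
    and a: "a \<in> carrier S" and b: "b \<in> carrier S"
    and at: "\<And>e. e \<in> atoms \<Longrightarrow> a \<otimes> e = b \<otimes> e"
    and e: "e \<in> E"
  shows "a \<otimes> e = b \<otimes> e"
  using e
proof (induction "card {h \<in> E. e \<otimes> h = h}" arbitrary: e rule: less_induct)
  case less
  have finE: "finite {h \<in> E. P h}" for P
    by (rule finite_subset[OF _ fin]) auto
  have smaller: "a \<otimes> f = b \<otimes> f" if f: "f \<in> E" "e \<otimes> f = f" "f \<noteq> e" for f
  proof (rule less.hyps[OF _ f(1)])
    have fe: "f \<otimes> e = f"
      using idem_commute[OF f(1) less.prems] f(2) by simp
    have "{h \<in> E. f \<otimes> h = h} \<subseteq> {h \<in> E. e \<otimes> h = h}"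
    proof safe
      fix h assume h: "h \<in> E" "f \<otimes> h = h"
      show "e \<otimes> h = h"
        using m_assoc[of e f h] h f less.prems by (metis idem_closed)
    qed
    moreover have "e \<in> {h \<in> E. e \<otimes> h = h} - {h \<in> E. f \<otimes> h = h}"
      using f fe less.prems by auto
    ultimately show "card {h \<in> E. f \<otimes> h = h} < card {h \<in> E. e \<otimes> h = h}"
      by (intro psubset_card_mono finE) blast
  qed
  show ?case
  proof (cases "e = \<zero>\<^sub>S \<or> e \<in> atoms")
    case True
    then show ?thesis using a b at by auto
  next
    case False
    then obtain f where f: "f \<in> E" "e \<otimes> f = f" "f \<noteq> \<zero>\<^sub>S" "f \<noteq> e"
      using less.prems by (auto simp: atoms_def)
    obtain g where g: "g \<in> E" "e \<otimes> g = g" "g \<noteq> e" "e = f \<squnion>\<^bsub>natural_order S\<^esub> g"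
      using relative_complement[OF less.prems f(1,2,3)] .
    have "compatible S f g"
      using f g by (simp add: compatible_def idem_mult_closed)
    then have "c \<otimes> e = (c \<otimes> f) \<squnion>\<^bsub>natural_order S\<^esub> (c \<otimes> g)" if "c \<in> carrier S" for c
      unfolding g(4) using l_distrib[of f g c] f g(1) that by simp
    then show ?thesis
      using smaller[OF f(1,2,4)] smaller[OF g(1,2,3)] a b by simp
  qed
qed

end

section \<open>Orthogonal sums\<close>

context boolean_inverse_monoid
begin

text \<open>The join \<open>s\<close> of an orthogonal family is described by its two-sided products only. All that is
  ever needed is that \<open>csd\<close> is \<open>cu\<^sub>kd\<close> if the other members of the family contribute zero.
  Letting the distinguished index \<open>k\<^sub>0\<close> lie outside \<open>K\<close> covers the case where all contributions
  vanish; in the induction step this case, with \<open>k\<^sub>0\<close> the new index, yields that the partial join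
  is orthogonal to the new member.\<close>

lemma orthogonal_sum:
  assumes "finite K" "\<And>k. k \<in> K \<Longrightarrow> u k \<in> carrier S"
    and "\<And>k l. \<lbrakk>k \<in> K; l \<in> K; k \<noteq> l\<rbrakk> \<Longrightarrow> orthogonal (u k) (u l)"
  shows "\<exists>s\<in>carrier S. \<forall>c\<in>carrier S. \<forall>d\<in>carrier S. \<forall>k\<^sub>0.
    (\<forall>k\<in>K - {k\<^sub>0}. c \<otimes> (u k \<otimes> d) = \<zero>\<^sub>S)
      \<longrightarrow> c \<otimes> (s \<otimes> d) = (if k\<^sub>0 \<in> K then c \<otimes> (u k\<^sub>0 \<otimes> d) else \<zero>\<^sub>S)"
  using assms
proof (induction K rule: finite_induct)
  case empty
  show ?case by (rule bexI[of _ "\<zero>\<^sub>S"]) auto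
next
  case (insert l K)
  obtain s where s: "s \<in> carrier S" and
    s_eq: "\<And>c d k\<^sub>0. \<lbrakk>c \<in> carrier S; d \<in> carrier S;
        \<forall>k\<in>K - {k\<^sub>0}. c \<otimes> (u k \<otimes> d) = \<zero>\<^sub>S\<rbrakk>
      \<Longrightarrow> c \<otimes> (s \<otimes> d) = (if k\<^sub>0 \<in> K then c \<otimes> (u k\<^sub>0 \<otimes> d) else \<zero>\<^sub>S)"
    using insert.IH insert.prems by auto
  have l: "u l \<in> carrier S" and uK: "\<And>k. k \<in> K \<Longrightarrow> u k \<in> carrier S"
    using insert.prems(1) by auto
  have ul: "(u l)\<dagger> \<otimes> u k = \<zero>\<^sub>S \<and> u k \<otimes> (u l)\<dagger> = \<zero>\<^sub>S" if "k \<in> K" for k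
    using that insert.hyps(2) insert.prems(2)[of l k] insert.prems(2)[of k l]
    by (auto simp: orthogonal_def)
  have "(u l)\<dagger> \<otimes> (s \<otimes> \<one>) = \<zero>\<^sub>S"
    using s_eq[of "(u l)\<dagger>" \<one> l] ul uK l insert.hyps(2) by simp
  then have lys: "(u l)\<dagger> \<otimes> s = \<zero>\<^sub>S" using s by simp
  have "\<one> \<otimes> (s \<otimes> (u l)\<dagger>) = \<zero>\<^sub>S"
    using s_eq[of \<one> "(u l)\<dagger>" l] ul uK l insert.hyps(2) by simp
  then have "s \<otimes> (u l)\<dagger> = \<zero>\<^sub>S" using s l by simp
  moreover have "s\<dagger> \<otimes> u l = \<zero>\<^sub>S"
    using lys s l dagger_mult[of "(u l)\<dagger>" s] by simp
  ultimately have orth: "orthogonal s (u l)"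
    by (simp add: orthogonal_def)
  show ?case
  proof (rule bexI[of _ "s \<squnion>\<^bsub>natural_order S\<^esub> u l"], intro ballI allI impI)
    fix c d k\<^sub>0
    assume c: "c \<in> carrier S" and d: "d \<in> carrier S"
      and z: "\<forall>k\<in>insert l K - {k\<^sub>0}. c \<otimes> (u k \<otimes> d) = \<zero>\<^sub>S"
    have 1: "c \<otimes> (s \<otimes> d) = (if k\<^sub>0 \<in> K then c \<otimes> (u k\<^sub>0 \<otimes> d) else \<zero>\<^sub>S)"
      using z by (intro s_eq c d) auto
    have 2: "c \<otimes> (u l \<otimes> d) = \<zero>\<^sub>S" if "k\<^sub>0 \<noteq> l" using z that by auto
    have 3: "c \<otimes> (u k \<otimes> d) \<in> carrier S" if "k \<in> insert l K" for k
      using that uK l c d by (auto simp: m_closed)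
    show "c \<otimes> ((s \<squnion>\<^bsub>natural_order S\<^esub> u l) \<otimes> d)
      = (if k\<^sub>0 \<in> insert l K then c \<otimes> (u k\<^sub>0 \<otimes> d) else \<zero>\<^sub>S)"
      unfolding mult_orthogonal_join[OF orth s l c d] 1
      using 2 3 insert.hyps(2) by (cases "k\<^sub>0 = l") (simp_all add: join_zero)
  qed (rule orthogonal_join_closed[OF orth s l])
qed

end

section \<open>Rook matrices over a group with zero\<close>

lemma adjoin_zero_mult:
  "p \<otimes>\<^bsub>adjoin_zero G\<^esub> q = (case (p, q) of (Some g, Some h) \<Rightarrow> Some (g \<otimes>\<^bsub>G\<^esub> h) | _ \<Rightarrow> None)"
  by (simp add: adjoin_zero_def)

lemma adjoin_zero_mult_simps [simp]:
  "Some g \<otimes>\<^bsub>adjoin_zero G\<^esub> Some h = Some (g \<otimes>\<^bsub>G\<^esub> h)"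
  "None \<otimes>\<^bsub>adjoin_zero G\<^esub> q = None" "p \<otimes>\<^bsub>adjoin_zero G\<^esub> None = None"
  by (simp_all add: adjoin_zero_mult split: option.split)

lemma adjoin_zero_carrier [simp]: "carrier (adjoin_zero G) = insert None (Some ` carrier G)"
  by (simp add: adjoin_zero_def)

lemma adjoin_zero_zero [simp]: "sg_zero (adjoin_zero G) = None"
  unfolding sg_zero_def
proof (rule the_equality)
  fix z assume "is_sg_zero (adjoin_zero G) z"
  then have "z \<otimes>\<^bsub>adjoin_zero G\<^esub> None = z"
    unfolding is_sg_zero_def by auto
  then show "z = None" by simp
qed (auto simp: is_sg_zero_def)

lemma adjoin_zero_sg_inv_None [simp]: "sg_inv (adjoin_zero G) None = None"
  unfolding sg_inv_def
proof (rule the_equality)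
  fix b assume "b \<in> carrier (adjoin_zero G) \<and>
    None \<otimes>\<^bsub>adjoin_zero G\<^esub> b \<otimes>\<^bsub>adjoin_zero G\<^esub> None = None \<and>
    b \<otimes>\<^bsub>adjoin_zero G\<^esub> None \<otimes>\<^bsub>adjoin_zero G\<^esub> b = b"
  then show "b = None" by simp
qed simp

context group
begin

lemma adjoin_zero_sg_inv_Some:
  assumes g: "g \<in> carrier G"
  shows "sg_inv (adjoin_zero G) (Some g) = Some (inv g)"
  unfolding sg_inv_def
proof (rule the_equality)
  fix b assume b: "b \<in> carrier (adjoin_zero G) \<and>
    Some g \<otimes>\<^bsub>adjoin_zero G\<^esub> b \<otimes>\<^bsub>adjoin_zero G\<^esub> Some g = Some g \<and>
    b \<otimes>\<^bsub>adjoin_zero G\<^esub> Some g \<otimes>\<^bsub>adjoin_zero G\<^esub> b = b"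
  then obtain h where h: "b = Some h" "h \<in> carrier G" by auto
  with b have "g \<otimes> h \<otimes> g = g" by simp
  then have "g \<otimes> h = \<one>" using g h r_cancel_one by (metis m_closed)
  then show "b = Some (inv g)"
    using g h inv_comm inv_equality by metis
qed (use g in auto)

lemma adjoin_zero_le:
  assumes "p \<in> carrier (adjoin_zero G)" "q \<in> carrier (adjoin_zero G)"
  shows "p \<sqsubseteq>\<^bsub>natural_order (adjoin_zero G)\<^esub> q \<longleftrightarrow> p = None \<or> p = q"
  using assms
  by (cases p; cases q) (auto simp: natural_order_def adjoin_zero_sg_inv_Some m_assoc)

text \<open>Among the nonzero elements the natural order of a group with zero is trivial. Thus the join that
  defines an entry of a product of rook matrices picks the only nonzero term.\<close>

lemma adjoin_zero_sup:
  assumes v: "v ` A \<subseteq> carrier (adjoin_zero G)" and k: "k \<in> A"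
    and others: "\<And>l. \<lbrakk>l \<in> A; l \<noteq> k\<rbrakk> \<Longrightarrow> v l = None"
  shows "\<Squnion>\<^bsub>natural_order (adjoin_zero G)\<^esub> (v ` A) = v k"
proof -
  let ?L = "natural_order (adjoin_zero G)"
  have car: "carrier ?L = carrier (adjoin_zero G)" by (simp add: natural_order_def)
  have vk: "v k \<in> carrier ?L" unfolding car using v k by blast
  have ub: "x \<sqsubseteq>\<^bsub>?L\<^esub> y \<longleftrightarrow> x = None \<or> x = y" if "x \<in> carrier ?L" "y \<in> carrier ?L" for x y
    using that unfolding car by (rule adjoin_zero_le)
  have up: "v k \<in> Upper ?L (v ` A)"
    unfolding Upper_def using vk others by (auto simp: ub)
  have low: "v k \<sqsubseteq>\<^bsub>?L\<^esub> y" if "y \<in> Upper ?L (v ` A)" for y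
    using that vk k unfolding Upper_def by blast
  show ?thesis
    unfolding sup_def
  proof (rule some_equality)
    show "is_lub ?L (v k) (v ` A)"
      unfolding least_def using up low by (auto simp: Upper_def)
    fix y assume y: "is_lub ?L y (v ` A)"
    then have "y \<sqsubseteq>\<^bsub>?L\<^esub> v k" and yU: "y \<in> Upper ?L (v ` A)" using up by (auto simp: least_def)
    moreover have "y \<in> carrier ?L" using yU by (simp add: Upper_def)
    ultimately show "y = v k" using low[OF yU] vk ub by metis
  qed
qed

lemma rook_matrices_adjoin_zero:
  "A \<in> rook_matrices n (adjoin_zero G) \<longleftrightarrow> A \<in> carrier_mat n n \<and>
     (\<forall>i<n. \<forall>j<n. A $$ (i, j) \<in> carrier (adjoin_zero G)) \<and>
     (\<forall>i<n. \<forall>j<n. \<forall>k<n. j \<noteq> k \<longrightarrow> A $$ (i, j) = None \<or> A $$ (i, k) = None) \<and>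
     (\<forall>i<n. \<forall>j<n. \<forall>k<n. i \<noteq> k \<longrightarrow> A $$ (i, j) = None \<or> A $$ (k, j) = None)"
proof -
  have 1: "sg_inv (adjoin_zero G) p \<otimes>\<^bsub>adjoin_zero G\<^esub> q = None \<longleftrightarrow> p = None \<or> q = None"
    if "p \<in> carrier (adjoin_zero G)" for p q
    using that by (cases p; cases q) (auto simp: adjoin_zero_sg_inv_Some)
  have 2: "q \<otimes>\<^bsub>adjoin_zero G\<^esub> sg_inv (adjoin_zero G) p = None \<longleftrightarrow> q = None \<or> p = None"
    if "p \<in> carrier (adjoin_zero G)" for p q
    using that by (cases p; cases q) (auto simp: adjoin_zero_sg_inv_Some)
  show ?thesis
    unfolding rook_matrices_def adjoin_zero_zero
    by (intro iffI CollectI; elim CollectE conjE; intro conjI allI impI)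
      (simp_all del: adjoin_zero_carrier add: 1 2)
qed

end

section \<open>Coordinates\<close>

context boolean_inverse_monoid
begin

text \<open>The maximal subgroup at \<open>e\<close>; for an atom \<open>e\<close> it consists of all nonzero elements of \<open>eSe\<close>.\<close>

definition local_group :: "'a \<Rightarrow> 'a monoid" where
  "local_group e = \<lparr>carrier = {g \<in> carrier S. g\<dagger> \<otimes> g = e \<and> g \<otimes> g\<dagger> = e},
     monoid.mult = (\<otimes>), one = e\<rparr>"

lemma local_group_carrier:
  "g \<in> carrier (local_group e) \<longleftrightarrow> g \<in> carrier S \<and> g\<dagger> \<otimes> g = e \<and> g \<otimes> g\<dagger> = e"
  by (simp add: local_group_def)

lemma local_group_mult [simp]: "g \<otimes>\<^bsub>local_group e\<^esub> h = g \<otimes> h"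
  by (simp add: local_group_def)

lemma local_group_absorb:
  assumes "g \<in> carrier (local_group e)"
  shows "e \<otimes> g = g" "g \<otimes> e = g"
  using assms dagger_props[of g] mult_dagger_mult[of g] by (auto simp: local_group_carrier)

lemma local_group_group:
  assumes "e \<in> E"
  shows "group (local_group e)"
proof (rule groupI)
  fix g h assume g: "g \<in> carrier (local_group e)" and h: "h \<in> carrier (local_group e)"
  have gS: "g \<in> carrier S" and hS: "h \<in> carrier S"
    using g h by (simp_all add: local_group_carrier)
  have "(g \<otimes> h)\<dagger> \<otimes> (g \<otimes> h) = h\<dagger> \<otimes> ((g\<dagger> \<otimes> g) \<otimes> h)"
    using gS hS by (simp add: dagger_mult m_assoc)
  also have "\<dots> = e"
    using g h local_group_absorb(1)[OF h] by (simp add: local_group_carrier)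
  finally have 1: "(g \<otimes> h)\<dagger> \<otimes> (g \<otimes> h) = e" .
  have "(g \<otimes> h) \<otimes> (g \<otimes> h)\<dagger> = (g \<otimes> (h \<otimes> h\<dagger>)) \<otimes> g\<dagger>"
    using gS hS by (simp add: dagger_mult m_assoc)
  also have "\<dots> = e"
    using g h local_group_absorb(2)[OF g] by (simp add: local_group_carrier)
  finally show "g \<otimes>\<^bsub>local_group e\<^esub> h \<in> carrier (local_group e)"
    using 1 gS hS by (simp add: local_group_carrier)
next
  fix g assume g: "g \<in> carrier (local_group e)"
  then show "\<exists>h\<in>carrier (local_group e). h \<otimes>\<^bsub>local_group e\<^esub> g = \<one>\<^bsub>local_group e\<^esub>"
    by (intro bexI[of _ "g\<dagger>"]) (auto simp: local_group_def)
  show "\<one>\<^bsub>local_group e\<^esub> \<otimes>\<^bsub>local_group e\<^esub> g = g"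
    using local_group_absorb(1)[OF g] by (simp add: local_group_def)
qed (use assms in \<open>simp_all add: local_group_def m_assoc\<close>)

end

text \<open>The atoms fall into classes indexed by \<open>I\<close>, two of them being equivalent if some \<open>y\<close> leads
  from one, as \<open>y\<dagger>y\<close>, to the other, as \<open>yy\<dagger>\<close>. In the class \<open>i\<close> an atom \<open>e i\<close> serves as base
  point, and \<open>x i j\<close> is a chosen element leading from \<open>e i\<close> to the \<open>j\<close>-th atom of the class. The
  last two assumptions say that every atom is listed in some class and that the atoms reachable from
  \<open>e i\<close> are all listed in the class \<open>i\<close>.\<close>

locale matrix_coordinates = boolean_inverse_monoid S for S (structure) +
  fixes I :: "'i set" and n :: "'i \<Rightarrow> nat" and e :: "'i \<Rightarrow> 'a" and x :: "'i \<Rightarrow> nat \<Rightarrow> 'a"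
  assumes carrier_finite: "finite (carrier S)"
    and index_finite: "finite I"
    and base_atom: "i \<in> I \<Longrightarrow> e i \<in> atoms"
    and x_closed [simp]: "\<lbrakk>i \<in> I; j < n i\<rbrakk> \<Longrightarrow> x i j \<in> carrier S"
    and x_dom: "\<lbrakk>i \<in> I; j < n i\<rbrakk> \<Longrightarrow> (x i j)\<dagger> \<otimes> x i j = e i"
    and x_ran_inj: "\<lbrakk>i \<in> I; j < n i; k \<in> I; l < n k; x i j \<otimes> (x i j)\<dagger> = x k l \<otimes> (x k l)\<dagger>\<rbrakk>
      \<Longrightarrow> i = k \<and> j = l"
    and x_ran_cover: "f \<in> atoms \<Longrightarrow> \<exists>i\<in>I. \<exists>j<n i. f = x i j \<otimes> (x i j)\<dagger>"
    and x_ran_block: "\<lbrakk>i \<in> I; y \<in> carrier S; y\<dagger> \<otimes> y = e i\<rbrakk>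
      \<Longrightarrow> \<exists>j<n i. y \<otimes> y\<dagger> = x i j \<otimes> (x i j)\<dagger>"
begin

text \<open>Moving \<open>a\<close> back to the base point along the chosen elements: the part of \<open>a\<close> leading from the
  \<open>k\<close>-th to the \<open>j\<close>-th atom becomes a member of the group at \<open>e i\<close>, or zero if there is no such
  part.\<close>

definition entry :: "'a \<Rightarrow> 'i \<Rightarrow> nat \<Rightarrow> nat \<Rightarrow> 'a" where
  "entry a i j k = (x i j)\<dagger> \<otimes> (a \<otimes> x i k)"

definition drop_zero :: "'a \<Rightarrow> 'a option" where
  "drop_zero y = (if y = \<zero>\<^sub>S then None else Some y)"

definition coords :: "'a \<Rightarrow> 'i \<Rightarrow> 'a option mat" where
  "coords a = (\<lambda>i\<in>I. mat (n i) (n i) (\<lambda>(j, k). drop_zero (entry a i j k)))"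

lemma base_idem: "i \<in> I \<Longrightarrow> e i \<in> E"
  by (rule atomsD(1)[OF base_atom])

lemma x_base: "\<lbrakk>i \<in> I; j < n i\<rbrakk> \<Longrightarrow> x i j \<otimes> e i = x i j"
  using mult_dagger_mult[of "x i j"] by (simp add: x_dom)

lemma base_x_dagger: "\<lbrakk>i \<in> I; j < n i\<rbrakk> \<Longrightarrow> e i \<otimes> (x i j)\<dagger> = (x i j)\<dagger>"
  using dagger_mult_dagger[of "x i j"] by (simp add: x_dom[symmetric] m_assoc)

lemma x_ran_atom: "\<lbrakk>i \<in> I; j < n i\<rbrakk> \<Longrightarrow> x i j \<otimes> (x i j)\<dagger> \<in> atoms"
  by (simp add: ran_atom x_dom base_atom)

lemma x_orthogonal:
  assumes "i \<in> I" "j < n i" "k \<in> I" "l < n k" "(i, j) \<noteq> (k, l)"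
  shows "(x i j)\<dagger> \<otimes> x k l = \<zero>\<^sub>S"
proof -
  have "(x i j)\<dagger> \<otimes> x k l
    = (x i j)\<dagger> \<otimes> ((x i j \<otimes> (x i j)\<dagger>) \<otimes> (x k l \<otimes> (x k l)\<dagger>)) \<otimes> x k l"
    using assms by (simp add: inv_simps)
  also have "(x i j \<otimes> (x i j)\<dagger>) \<otimes> (x k l \<otimes> (x k l)\<dagger>) = \<zero>\<^sub>S"
    using assms x_ran_inj by (intro atoms_disjoint x_ran_atom) blast+
  finally show ?thesis using assms by simp
qed

lemma entry_closed [simp]:
  "\<lbrakk>a \<in> carrier S; i \<in> I; j < n i; k < n i\<rbrakk> \<Longrightarrow> entry a i j k \<in> carrier S"
  by (simp add: entry_def)

lemma entry_local_group:
  assumes "a \<in> carrier S" "i \<in> I" "j < n i" "k < n i" "entry a i j k \<noteq> \<zero>\<^sub>S"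
  shows "entry a i j k \<in> carrier (local_group (e i))"
  unfolding local_group_carrier
proof (intro conjI)
  have ei: "e i \<in> carrier S" using assms(2) base_idem idem_closed by blast
  have "entry a i j k \<otimes> e i = (x i j)\<dagger> \<otimes> (a \<otimes> (x i k \<otimes> e i))"
    using assms ei by (simp add: entry_def m_assoc)
  then have "entry a i j k \<otimes> e i = entry a i j k"
    using assms by (simp add: x_base entry_def)
  then show "(entry a i j k)\<dagger> \<otimes> entry a i j k = e i"
    using assms by (intro dom_eq_atom base_atom entry_closed)
  have "e i \<otimes> entry a i j k = (e i \<otimes> (x i j)\<dagger>) \<otimes> (a \<otimes> x i k)"
    using assms ei by (simp add: entry_def m_assoc)
  then have "e i \<otimes> entry a i j k = entry a i j k"
    using assms by (simp add: base_x_dagger entry_def)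
  then show "entry a i j k \<otimes> (entry a i j k)\<dagger> = e i"
    using assms by (intro ran_eq_atom base_atom entry_closed)
qed (use assms in simp)

lemma drop_zero_entry:
  assumes "a \<in> carrier S" "i \<in> I" "j < n i" "k < n i"
  shows "drop_zero (entry a i j k) \<in> carrier (adjoin_zero (local_group (e i)))"
  using entry_local_group[OF assms] by (simp add: drop_zero_def)

lemma entry_dagger:
  assumes "a \<in> carrier S" "i \<in> I" "j < n i" "k < n i"
  shows "entry (a\<dagger>) i j k = (entry a i k j)\<dagger>"
  using assms by (simp add: entry_def dagger_mult m_assoc)

text \<open>If \<open>w = (x i j)\<dagger>a\<close> is nonzero, then \<open>ww\<dagger>\<close> is the atom \<open>e i\<close>, so \<open>w\<dagger>w\<close> is an atom too. As
  distinct atoms are disjoint, \<open>w\<close> can only meet the column whose atom is \<open>w\<dagger>w\<close>.\<close>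

lemma entry_row:
  assumes a: "a \<in> carrier S" and i: "i \<in> I" "j < n i" "k < n i" "l < n i"
    and k: "entry a i j k \<noteq> \<zero>\<^sub>S" and l: "entry a i j l \<noteq> \<zero>\<^sub>S"
  shows "k = l"
proof -
  define w where "w = (x i j)\<dagger> \<otimes> a"
  have w: "w \<in> carrier S" using a i by (simp add: w_def)
  have ent: "entry a i j m = w \<otimes> x i m" if "m < n i" for m
    using a i that by (simp add: entry_def w_def m_assoc)
  have "e i \<otimes> w = (e i \<otimes> (x i j)\<dagger>) \<otimes> a"
    unfolding w_def using a i base_idem[OF i(1)] by (simp add: m_assoc)
  then have "e i \<otimes> w = w" using i by (simp add: base_x_dagger w_def)
  moreover have "w \<noteq> \<zero>\<^sub>S" using k ent i by auto
  ultimately have "w \<otimes> w\<dagger> = e i"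
    using w i by (intro ran_eq_atom base_atom)
  then have wa: "w\<dagger> \<otimes> w \<in> atoms"
    using w base_atom[OF i(1)] by (intro dom_atom) simp_all
  have dom: "w\<dagger> \<otimes> w = x i m \<otimes> (x i m)\<dagger>" if m: "m < n i" "entry a i j m \<noteq> \<zero>\<^sub>S" for m
  proof (rule ccontr)
    assume "w\<dagger> \<otimes> w \<noteq> x i m \<otimes> (x i m)\<dagger>"
    then have "(w\<dagger> \<otimes> w) \<otimes> (x i m \<otimes> (x i m)\<dagger>) = \<zero>\<^sub>S"
      using wa x_ran_atom i m by (intro atoms_disjoint) auto
    then have "w \<otimes> ((w\<dagger> \<otimes> w) \<otimes> (x i m \<otimes> (x i m)\<dagger>)) \<otimes> x i m = \<zero>\<^sub>S"
      using w i m by simp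
    then have "w \<otimes> x i m = \<zero>\<^sub>S"
      using w i m by (simp add: inv_simps)
    then show False using m ent by simp
  qed
  show ?thesis
    using dom[OF i(3) k] dom[OF i(4) l] x_ran_inj[OF i(1,3) i(1,4)] by simp
qed

lemma entry_column:
  assumes "a \<in> carrier S" "i \<in> I" "j < n i" "k < n i" "l < n i"
    and "entry a i k j \<noteq> \<zero>\<^sub>S" "entry a i l j \<noteq> \<zero>\<^sub>S"
  shows "k = l"
  using entry_row[of "a\<dagger>" i j k l] assms by (simp add: entry_dagger dagger_eq_zero_iff)

lemma group_local: "i \<in> I \<Longrightarrow> group (local_group (e i))"
  by (rule local_group_group[OF base_idem])

lemma coords_rook:
  assumes a: "a \<in> carrier S" and i: "i \<in> I"
  shows "coords a i \<in> rook_matrices (n i) (adjoin_zero (local_group (e i)))"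
  unfolding group.rook_matrices_adjoin_zero[OF group_local[OF i]]
  using a i drop_zero_entry[OF a i] entry_row[OF a i] entry_column[OF a i]
  by (auto simp: coords_def drop_zero_def split: if_splits)

text \<open>The range of an element \<open>y\<close> starting at \<open>e i\<close> is an atom of the class \<open>i\<close>, so \<open>y\<close> passes
  through exactly one of the listed atoms. Multiplicativity and injectivity of the coordinates both
  come down to this.\<close>

lemma through_block:
  assumes "y \<in> carrier S" "y \<noteq> \<zero>\<^sub>S" "i \<in> I" "y \<otimes> e i = y"
  obtains l where "l < n i" "x i l \<otimes> ((x i l)\<dagger> \<otimes> y) = y"
proof -
  have dom: "y\<dagger> \<otimes> y = e i" using assms by (intro dom_eq_atom base_atom)
  obtain l where l: "l < n i" "y \<otimes> y\<dagger> = x i l \<otimes> (x i l)\<dagger>"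
    using x_ran_block[OF assms(3,1) dom] by blast
  have "x i l \<otimes> ((x i l)\<dagger> \<otimes> y) = (x i l \<otimes> (x i l)\<dagger>) \<otimes> y"
    using assms l by (simp add: m_assoc)
  also have "\<dots> = y"
    unfolding l(2)[symmetric] using assms by (simp add: inv_simps)
  finally show thesis using that l by blast
qed

text \<open>Unless it is zero, \<open>b(x i k)\<close> ends at a single atom of the class, the \<open>l\<close>-th say. Inserting the idempotent of that
  atom splits the entry of \<open>ab\<close> into two factors, and for any other index the entry of \<open>b\<close> vanishes.
  If \<open>b(x i k)\<close> is zero, all terms vanish and any index will do.\<close>

lemma entry_mult:
  assumes a: "a \<in> carrier S" and b: "b \<in> carrier S" and i: "i \<in> I" "j < n i" "k < n i"
  obtains l where "l < n i" "entry (a \<otimes> b) i j k = entry a i j l \<otimes> entry b i l k"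
    "\<And>m. \<lbrakk>m < n i; m \<noteq> l\<rbrakk> \<Longrightarrow> entry b i m k = \<zero>\<^sub>S"
proof (cases "b \<otimes> x i k = \<zero>\<^sub>S")
  case True
  then have "entry b i m k = \<zero>\<^sub>S" if "m < n i" for m
    using that i by (simp add: entry_def)
  moreover have "entry (a \<otimes> b) i j k = \<zero>\<^sub>S"
    using True a b i by (simp add: entry_def m_assoc)
  ultimately show thesis using a i by (intro that[OF i(2)]) simp_all
next
  case False
  have "(b \<otimes> x i k) \<otimes> e i = b \<otimes> x i k"
    using b i base_idem by (simp add: m_assoc x_base)
  then obtain l where l: "l < n i" "x i l \<otimes> ((x i l)\<dagger> \<otimes> (b \<otimes> x i k)) = b \<otimes> x i k"
    using through_block[of "b \<otimes> x i k" i] False b i by auto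
  have "entry (a \<otimes> b) i j k = (x i j)\<dagger> \<otimes> (a \<otimes> (b \<otimes> x i k))"
    using a b i by (simp add: entry_def m_assoc)
  also have "\<dots> = (x i j)\<dagger> \<otimes> (a \<otimes> (x i l \<otimes> ((x i l)\<dagger> \<otimes> (b \<otimes> x i k))))"
    using l by simp
  also have "\<dots> = entry a i j l \<otimes> entry b i l k"
    using a b i l(1) by (simp add: entry_def m_assoc)
  finally have "entry (a \<otimes> b) i j k = entry a i j l \<otimes> entry b i l k" .
  moreover have "entry b i m k = \<zero>\<^sub>S" if m: "m < n i" "m \<noteq> l" for m
  proof -
    have "entry b i m k = (x i m)\<dagger> \<otimes> (x i l \<otimes> ((x i l)\<dagger> \<otimes> (b \<otimes> x i k)))"
      using l by (simp add: entry_def)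
    also have "\<dots> = ((x i m)\<dagger> \<otimes> x i l) \<otimes> ((x i l)\<dagger> \<otimes> (b \<otimes> x i k))"
      using b i l(1) m by (simp add: m_assoc)
    finally show ?thesis
      using x_orthogonal[of i m i l] b i l(1) m by simp
  qed
  ultimately show thesis using that l(1) by blast
qed

text \<open>A product of two nonzero entries is nonzero since it stays in the group at \<open>f\<close>; replacing the
  zero of \<open>S\<close> by the adjoined zero is therefore multiplicative on entries.\<close>

lemma drop_zero_mult:
  assumes "group (local_group f)" "f \<noteq> \<zero>\<^sub>S"
    and "g = \<zero>\<^sub>S \<or> g \<in> carrier (local_group f)" "h = \<zero>\<^sub>S \<or> h \<in> carrier (local_group f)"
  shows "drop_zero (g \<otimes> h) = drop_zero g \<otimes>\<^bsub>adjoin_zero (local_group f)\<^esub> drop_zero h"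
proof (cases "g = \<zero>\<^sub>S \<or> h = \<zero>\<^sub>S")
  case True
  then show ?thesis using assms by (auto simp: drop_zero_def local_group_carrier)
next
  case False
  interpret G: group "local_group f" by fact
  have "g \<otimes> h \<in> carrier (local_group f)"
    using False assms G.m_closed by auto
  then have "g \<otimes> h \<noteq> \<zero>\<^sub>S" using assms(2) by (auto simp: local_group_carrier)
  then show ?thesis using False by (simp add: drop_zero_def)
qed

lemma coords_mult:
  assumes a: "a \<in> carrier S" and b: "b \<in> carrier S" and i: "i \<in> I"
  shows "coords (a \<otimes> b) i =
    coords a i \<otimes>\<^bsub>rook_matrix_semigroup (n i) (adjoin_zero (local_group (e i)))\<^esub> coords b i"
proof (rule eq_matI)
  fix j k
  let ?G = "adjoin_zero (local_group (e i))"
  assume "j < dim_row (coords a i \<otimes>\<^bsub>rook_matrix_semigroup (n i) ?G\<^esub> coords b i)"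
    and "k < dim_col (coords a i \<otimes>\<^bsub>rook_matrix_semigroup (n i) ?G\<^esub> coords b i)"
  then have jk: "j < n i" "k < n i" by (simp_all add: rook_matrix_semigroup_def)
  interpret G: group "local_group (e i)" by (rule group_local[OF i])
  have loc: "entry c i m l = \<zero>\<^sub>S \<or> entry c i m l \<in> carrier (local_group (e i))"
    if "c \<in> carrier S" "m < n i" "l < n i" for c m l
    using entry_local_group that i by blast
  define v where "v m = coords a i $$ (j, m) \<otimes>\<^bsub>?G\<^esub> coords b i $$ (m, k)" for m
  have v: "v m = drop_zero (entry a i j m \<otimes> entry b i m k)" if "m < n i" for m
    unfolding v_def using jk that i atomsD(3)[OF base_atom[OF i]]
    by (subst drop_zero_mult[OF G.group_axioms]) (auto simp: coords_def loc a b)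
  obtain l where l: "l < n i" "entry (a \<otimes> b) i j k = entry a i j l \<otimes> entry b i l k"
    "\<And>m. \<lbrakk>m < n i; m \<noteq> l\<rbrakk> \<Longrightarrow> entry b i m k = \<zero>\<^sub>S"
    using entry_mult[OF a b i jk] by blast
  have "\<Squnion>\<^bsub>natural_order ?G\<^esub> (v ` {..<n i}) = v l"
  proof (rule G.adjoin_zero_sup)
    have "v m \<in> carrier ?G" if "m < n i" for m
    proof -
      have "entry a i j m \<otimes> entry b i m k = \<zero>\<^sub>S \<or>
          entry a i j m \<otimes> entry b i m k \<in> carrier (local_group (e i))"
        using loc[OF a jk(1) that] loc[OF b that jk(2)] a b i jk that G.m_closed
        by (metis entry_closed local_group_mult zero_left zero_right)
      then show ?thesis
        unfolding v[OF that] by (auto simp: drop_zero_def)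
    qed
    then show "v ` {..<n i} \<subseteq> carrier ?G" by auto
    show "v m = None" if "m \<in> {..<n i}" "m \<noteq> l" for m
      using that v l(3) a i jk by (simp add: drop_zero_def)
  qed (use l in simp)
  then show "coords (a \<otimes> b) i $$ (j, k) =
      (coords a i \<otimes>\<^bsub>rook_matrix_semigroup (n i) ?G\<^esub> coords b i) $$ (j, k)"
    using jk i v[OF l(1)] l(2) by (simp add: rook_matrix_semigroup_def coords_def v_def)
qed (use i in \<open>simp_all add: rook_matrix_semigroup_def coords_def\<close>)

text \<open>The entries in column \<open>k\<close> of block \<open>i\<close> determine \<open>a(x i k)\<close> and hence the product of \<open>a\<close> with
  the corresponding atom, and the atoms separate elements.\<close>

lemma coords_inj: "inj_on coords (carrier S)"
proof (rule inj_onI)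
  \<comment> \<open>Comparing products with an atom is only direct where one of them is nonzero; both cases are
    then combined by symmetry.\<close>
  have half: "a \<otimes> f = b \<otimes> f"
    if a: "a \<in> carrier S" and b: "b \<in> carrier S" and eq: "coords a = coords b"
      and f: "f \<in> atoms" and nz: "a \<otimes> f \<noteq> \<zero>\<^sub>S" for a b f
  proof -
    obtain i k where i: "i \<in> I" "k < n i" and fk: "f = x i k \<otimes> (x i k)\<dagger>"
      using x_ran_cover[OF f] by blast
    have ent: "entry a i j m = entry b i j m" if "j < n i" "m < n i" for j m
      using arg_cong[OF eq, of "\<lambda>A. A i $$ (j, m)"] i that
      by (auto simp: coords_def drop_zero_def split: if_splits)
    have ax: "a \<otimes> x i k \<noteq> \<zero>\<^sub>S"
    proof
      assume "a \<otimes> x i k = \<zero>\<^sub>S"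
      then have "a \<otimes> x i k \<otimes> (x i k)\<dagger> = \<zero>\<^sub>S" using i by simp
      then show False using nz fk a i by (simp add: m_assoc)
    qed
    have thru: "\<exists>l<n i. x i l \<otimes> entry c i l k = c \<otimes> x i k"
      if "c \<in> carrier S" "c \<otimes> x i k \<noteq> \<zero>\<^sub>S" for c
    proof -
      have "(c \<otimes> x i k) \<otimes> e i = c \<otimes> x i k"
        using that i base_idem by (simp add: m_assoc x_base)
      then show ?thesis
        using through_block[of "c \<otimes> x i k" i] that i unfolding entry_def by (metis m_closed x_closed)
    qed
    obtain l where l: "l < n i" "x i l \<otimes> entry a i l k = a \<otimes> x i k"
      using thru[OF a ax] by blast
    have la: "entry a i l k \<noteq> \<zero>\<^sub>S" using l ax i by auto
    then have lb: "entry b i l k \<noteq> \<zero>\<^sub>S" using ent l i by simp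
    then have "b \<otimes> x i k \<noteq> \<zero>\<^sub>S" using i l by (auto simp: entry_def)
    then obtain m where m: "m < n i" "x i m \<otimes> entry b i m k = b \<otimes> x i k"
      using thru[OF b] by blast
    have "entry b i m k \<noteq> \<zero>\<^sub>S" using m \<open>b \<otimes> x i k \<noteq> \<zero>\<^sub>S\<close> i by auto
    then have "m = l" using entry_column[OF b i(1) i(2) m(1) l(1)] lb by simp
    then have "a \<otimes> x i k = b \<otimes> x i k" using l m ent i by simp
    then have "a \<otimes> x i k \<otimes> (x i k)\<dagger> = b \<otimes> x i k \<otimes> (x i k)\<dagger>" by simp
    then show ?thesis using fk a b i by (simp add: m_assoc)
  qed
  fix a b assume a: "a \<in> carrier S" and b: "b \<in> carrier S" and eq: "coords a = coords b"
  have "a \<otimes> f = b \<otimes> f" if "f \<in> atoms" for f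
    using half[OF a b eq that] half[OF b a eq[symmetric] that] by metis
  then have "a \<otimes> \<one> = b \<otimes> \<one>"
    using eq_on_idempotents_if_eq_on_atoms[OF carrier_finite a b _ idemI[of \<one>]] by simp
  then show "a = b" using a b by simp
qed

text \<open>The elements \<open>(x p q) g (x p r)\<dagger>\<close> play the part of matrix units scaled by \<open>g\<close>.\<close>

lemma unit_entry:
  assumes i: "i \<in> I" "j < n i" "k < n i" and p: "p \<in> I" "q < n p" "r < n p"
    and g: "g \<in> carrier (local_group (e p))"
  shows "(x i j)\<dagger> \<otimes> ((x p q \<otimes> (g \<otimes> (x p r)\<dagger>)) \<otimes> x i k)
    = (if (i, j, k) = (p, q, r) then g else \<zero>\<^sub>S)"
proof -
  have gS: "g \<in> carrier S" using g by (simp add: local_group_carrier)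
  have "(x i j)\<dagger> \<otimes> ((x p q \<otimes> (g \<otimes> (x p r)\<dagger>)) \<otimes> x i k)
    = ((x i j)\<dagger> \<otimes> x p q) \<otimes> (g \<otimes> ((x p r)\<dagger> \<otimes> x i k))"
    using i p gS by (simp add: m_assoc)
  also have "\<dots> = (if (i, j, k) = (p, q, r) then g else \<zero>\<^sub>S)"
  proof (cases "(i, j) = (p, q)")
    case True
    show ?thesis
    proof (cases "k = r")
      case True
      with \<open>(i, j) = (p, q)\<close> show ?thesis
        using i gS local_group_absorb[OF g] by (simp add: x_dom)
    next
      case False
      with \<open>(i, j) = (p, q)\<close> show ?thesis
        using x_orthogonal[of p r i k] i p gS by auto
    qed
  next
    case False
    then show ?thesis using x_orthogonal[of i j p q] i p gS by auto
  qed
  finally show ?thesis .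
qed

text \<open>Each nonzero entry of a family of rook matrices contributes a scaled matrix unit. That a row or
  column has at most one nonzero entry makes these units orthogonal, so that they have a join.\<close>

lemma coords_surj:
  assumes B: "B \<in> (\<Pi>\<^sub>E i\<in>I. rook_matrices (n i) (adjoin_zero (local_group (e i))))"
  shows "\<exists>s\<in>carrier S. coords s = B"
proof -
  define K where "K = {(i, j, k). i \<in> I \<and> j < n i \<and> k < n i \<and> B i $$ (j, k) \<noteq> None}"
  define u where "u = (\<lambda>(i, j, k). x i j \<otimes> (the (B i $$ (j, k)) \<otimes> (x i k)\<dagger>))"
  have "finite (Sigma I (\<lambda>i. {..<n i} \<times> {..<n i}))"
    using index_finite by auto
  then have K: "finite K"
    by (rule rev_finite_subset) (auto simp: K_def)
  have Bi: "B i \<in> carrier_mat (n i) (n i)"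
    "\<And>j k. \<lbrakk>j < n i; k < n i\<rbrakk> \<Longrightarrow> B i $$ (j, k) \<in> carrier (adjoin_zero (local_group (e i)))"
    "\<And>j k l. \<lbrakk>j < n i; k < n i; l < n i; k \<noteq> l\<rbrakk> \<Longrightarrow> B i $$ (j, k) = None \<or> B i $$ (j, l) = None"
    "\<And>j k l. \<lbrakk>j < n i; k < n i; l < n i; j \<noteq> l\<rbrakk> \<Longrightarrow> B i $$ (j, k) = None \<or> B i $$ (l, k) = None"
    if i: "i \<in> I" for i
    using PiE_mem[OF B i] unfolding group.rook_matrices_adjoin_zero[OF group_local[OF i]]
    by simp_all
  have g: "the (B i $$ (j, k)) \<in> carrier (local_group (e i))" "the (B i $$ (j, k)) \<in> carrier S"
    if "(i, j, k) \<in> K" for i j k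
    using that Bi(2)[of i j k] by (auto simp: K_def local_group_carrier)
  have u: "u t \<in> carrier S" if "t \<in> K" for t
  proof -
    obtain i j k where t: "t = (i, j, k)" by (cases t)
    then have "i \<in> I" "j < n i" "k < n i" using that by (auto simp: K_def)
    then show ?thesis using g(2)[OF that[unfolded t]] by (simp add: u_def t)
  qed
  have orth: "orthogonal (u t) (u t')" if t: "t \<in> K" "t' \<in> K" "t \<noteq> t'" for t t'
  proof -
    obtain i j k where tt: "t = (i, j, k)" by (cases t)
    obtain p q r where tt': "t' = (p, q, r)" by (cases t')
    let ?g = "the (B i $$ (j, k))" and ?h = "the (B p $$ (q, r))"
    note gS = g(2)[OF t(1)[unfolded tt]] g(2)[OF t(2)[unfolded tt']]
    have i: "i \<in> I" "j < n i" "k < n i" "B i $$ (j, k) \<noteq> None"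
      and p: "p \<in> I" "q < n p" "r < n p" "B p $$ (q, r) \<noteq> None"
      using t by (auto simp: K_def tt tt')
    have 1: "(i, j) \<noteq> (p, q)"
      using Bi(3)[of i j k r] i p t(3) by (auto simp: tt tt')
    have 2: "(i, k) \<noteq> (p, r)"
      using Bi(4)[of i j k q] i p t(3) by (auto simp: tt tt')
    have "(u t)\<dagger> \<otimes> u t' = (x i k \<otimes> ?g\<dagger>) \<otimes> (((x i j)\<dagger> \<otimes> x p q) \<otimes> (?h \<otimes> (x p r)\<dagger>))"
      using i p gS by (simp add: u_def tt tt' dagger_mult m_assoc)
    moreover have "u t \<otimes> (u t')\<dagger> = (x i j \<otimes> ?g) \<otimes> (((x i k)\<dagger> \<otimes> x p r) \<otimes> (?h\<dagger> \<otimes> (x p q)\<dagger>))"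
      using i p gS by (simp add: u_def tt tt' dagger_mult m_assoc)
    ultimately show ?thesis
      using x_orthogonal[OF i(1,2) p(1,2) 1] x_orthogonal[OF i(1,3) p(1,3) 2] i p gS
      by (simp add: orthogonal_def)
  qed
  from orthogonal_sum[OF K u orth] obtain s where s: "s \<in> carrier S"
    and s_all: "\<forall>c\<in>carrier S. \<forall>d\<in>carrier S. \<forall>t. (\<forall>t'\<in>K - {t}. c \<otimes> (u t' \<otimes> d) = \<zero>\<^sub>S)
      \<longrightarrow> c \<otimes> (s \<otimes> d) = (if t \<in> K then c \<otimes> (u t \<otimes> d) else \<zero>\<^sub>S)"
    by (rule bexE)
  note s_eq = s_all[rule_format]
  have "coords s = B"
  proof
    fix i
    show "coords s i = B i"
    proof (cases "i \<in> I")
      case i: True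
      show ?thesis
      proof (rule eq_matI)
        fix j k assume "j < dim_row (B i)" "k < dim_col (B i)"
        then have jk: "j < n i" "k < n i" using Bi(1)[OF i] by auto
        have ue: "(x i j)\<dagger> \<otimes> (u t \<otimes> x i k) =
            (if (i, j, k) = t then the (B i $$ (j, k)) else \<zero>\<^sub>S)" if t: "t \<in> K" for t
        proof -
          obtain p q r where tt: "t = (p, q, r)" by (cases t)
          have "p \<in> I" "q < n p" "r < n p" using t by (auto simp: tt K_def)
          then show ?thesis
            using unit_entry[OF i jk, of p q r] g(1)[OF t[unfolded tt]] by (simp add: u_def tt)
        qed
        have "entry s i j k = (if (i, j, k) \<in> K then the (B i $$ (j, k)) else \<zero>\<^sub>S)"
          unfolding entry_def
          using i jk ue by (subst s_eq[of _ _ "(i, j, k)"]) auto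
        moreover have "the (B i $$ (j, k)) \<noteq> \<zero>\<^sub>S" if "(i, j, k) \<in> K"
          using g(1)[OF that] atomsD(3)[OF base_atom[OF i]] by (auto simp: local_group_carrier)
        ultimately show "coords s i $$ (j, k) = B i $$ (j, k)"
          using i jk by (auto simp: coords_def drop_zero_def K_def)
      qed (use i Bi(1)[OF i] in \<open>simp_all add: coords_def\<close>)
    next
      case False
      then show ?thesis using PiE_arb[OF B False] by (simp add: coords_def)
    qed
  qed
  then show ?thesis using s by blast
qed

lemma coords_iso:
  "coords \<in> iso S (product_group I (\<lambda>i. rook_matrix_semigroup (n i) (adjoin_zero (local_group (e i)))))"
proof -
  have car: "carrier (rook_matrix_semigroup m G) = rook_matrices m G" for m and G :: "'c monoid"
    by (simp add: rook_matrix_semigroup_def)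
  have "coords a \<in> (\<Pi>\<^sub>E i\<in>I. rook_matrices (n i) (adjoin_zero (local_group (e i))))"
    if "a \<in> carrier S" for a
    using coords_rook[OF that] by (auto simp: coords_def)
  moreover have "coords (a \<otimes> b) = (\<lambda>i\<in>I. coords a i
      \<otimes>\<^bsub>rook_matrix_semigroup (n i) (adjoin_zero (local_group (e i)))\<^esub> coords b i)"
    if "a \<in> carrier S" "b \<in> carrier S" for a b
  proof
    fix i
    show "coords (a \<otimes> b) i = (\<lambda>i\<in>I. coords a i
      \<otimes>\<^bsub>rook_matrix_semigroup (n i) (adjoin_zero (local_group (e i)))\<^esub> coords b i) i"
      using coords_mult[OF that] by (cases "i \<in> I") (simp, simp add: coords_def)
  qed
  moreover have "B \<in> coords ` carrier S"
    if "B \<in> (\<Pi>\<^sub>E i\<in>I. rook_matrices (n i) (adjoin_zero (local_group (e i))))" for B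
    using coords_surj[OF that] by blast
  ultimately show ?thesis
    using coords_inj
    by (auto simp: iso_def hom_def bij_betw_def product_group_def car)
qed

end

section \<open>Existence of coordinates\<close>

context boolean_inverse_monoid
begin

text \<open>Green's relation \<open>\<D>\<close> restricted to atoms; that \<open>g\<close> is an atom as well is automatic.\<close>

definition D_atoms :: "('a \<times> 'a) set" where
  "D_atoms = {(f, g). f \<in> atoms \<and> (\<exists>y\<in>carrier S. y\<dagger> \<otimes> y = f \<and> y \<otimes> y\<dagger> = g)}"

lemma D_atoms_equiv: "equiv atoms D_atoms"
proof (rule equivI)
  show "D_atoms \<subseteq> atoms \<times> atoms"
    using ran_atom by (auto simp: D_atoms_def)
  show "refl_on atoms D_atoms"
  proof (rule refl_onI)
    fix f assume f: "f \<in> atoms"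
    note f' = atomsD(1,2)[OF f]
    show "(f, f) \<in> D_atoms"
      unfolding D_atoms_def using f f' by (auto intro!: bexI[of _ f])
  qed
  show "sym D_atoms"
  proof (rule symI)
    fix f g assume "(f, g) \<in> D_atoms"
    then obtain y where "f \<in> atoms" "y \<in> carrier S" "y\<dagger> \<otimes> y = f" "y \<otimes> y\<dagger> = g"
      by (auto simp: D_atoms_def)
    then show "(g, f) \<in> D_atoms"
      using ran_atom by (auto simp: D_atoms_def intro!: bexI[of _ "y\<dagger>"])
  qed
  show "trans D_atoms"
  proof (rule transI)
    fix f g h assume "(f, g) \<in> D_atoms" "(g, h) \<in> D_atoms"
    then obtain y z where y: "f \<in> atoms" "y \<in> carrier S" "y\<dagger> \<otimes> y = f" "y \<otimes> y\<dagger> = g"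
      and z: "z \<in> carrier S" "z\<dagger> \<otimes> z = g" "z \<otimes> z\<dagger> = h"
      by (auto simp: D_atoms_def)
    have "(z \<otimes> y)\<dagger> \<otimes> (z \<otimes> y) = y\<dagger> \<otimes> ((z\<dagger> \<otimes> z) \<otimes> y)"
      using y(2) z(1) by (simp add: dagger_mult m_assoc)
    also have "\<dots> = y\<dagger> \<otimes> ((y \<otimes> y\<dagger>) \<otimes> y)"
      using y(4) z(2) by simp
    also have "\<dots> = f"
      using dagger_props[OF y(2)] y(3) by simp
    finally have 1: "(z \<otimes> y)\<dagger> \<otimes> (z \<otimes> y) = f" .
    have "(z \<otimes> y) \<otimes> (z \<otimes> y)\<dagger> = z \<otimes> ((y \<otimes> y\<dagger>) \<otimes> z\<dagger>)"
      using y(2) z(1) by (simp add: dagger_mult m_assoc)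
    also have "\<dots> = z \<otimes> ((z\<dagger> \<otimes> z) \<otimes> z\<dagger>)"
      using y(4) z(2) by simp
    also have "\<dots> = h"
      using dagger_props[OF z(1)] z(3) by simp
    finally have "(z \<otimes> y) \<otimes> (z \<otimes> y)\<dagger> = h" .
    then show "(f, h) \<in> D_atoms"
      using 1 y(1,2) z(1) by (auto simp: D_atoms_def intro!: bexI[of _ "z \<otimes> y"])
  qed
qed

lemma atoms_nonempty:
  assumes "finite (carrier S)"
  shows "atoms \<noteq> {}"
proof
  assume "atoms = {}"
  then have "\<one> \<otimes> \<one> = \<zero>\<^sub>S \<otimes> \<one>"
    using eq_on_idempotents_if_eq_on_atoms[OF assms one_closed zero_closed _ idemI[of \<one>]]
    by simp
  then have "\<one> = \<zero>\<^sub>S" by simp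
  then have "y = \<zero>\<^sub>S" if "y \<in> carrier S" for y
    using l_one[OF that] zero_left[OF that] by simp
  then have "carrier S = {\<zero>\<^sub>S}" using zero_closed by blast
  then show False using not_zero_semigroup by contradiction
qed

lemma matrix_coordinates_exist:
  assumes fin: "finite (carrier S)"
  obtains r :: nat and n e x where "r \<ge> 1" "matrix_coordinates S {1..r} n e x"
    "\<forall>i\<in>{1..r}. n i \<ge> 1"
proof -
  define Q where "Q = atoms // D_atoms"
  have fin_atoms: "finite atoms"
    by (rule finite_subset[OF _ fin]) (auto simp: atomsD)
  then have Q: "finite Q"
    unfolding Q_def using equiv_type[OF D_atoms_equiv] by (rule finite_quotient)
  define r where "r = card Q"
  have "Q \<noteq> {}"
    using atoms_nonempty[OF fin] by (auto simp: Q_def quotient_def)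
  then have r: "r \<ge> 1" using Q by (simp add: r_def Suc_le_eq card_gt_0_iff)
  obtain h where h: "bij_betw h {1..r} Q"
    unfolding r_def using ex_bij_betw_nat_finite_1[OF Q] by blast
  have hQ: "h i \<in> Q" if "i \<in> {1..r}" for i
    using h that by (auto simp: bij_betw_def)
  have "\<forall>i\<in>{1..r}. \<exists>f. f \<in> atoms \<and> h i = D_atoms `` {f}"
    using hQ unfolding Q_def quotient_def by blast
  then obtain e where e: "\<And>i. i \<in> {1..r} \<Longrightarrow> e i \<in> atoms"
    and he: "\<And>i. i \<in> {1..r} \<Longrightarrow> h i = D_atoms `` {e i}"
    by metis
  have h_sub: "h i \<subseteq> atoms" if "i \<in> {1..r}" for i
    unfolding he[OF that] using equiv_type[OF D_atoms_equiv] by auto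
  have h_fin: "finite (h i)" if "i \<in> {1..r}" for i
    by (rule finite_subset[OF h_sub[OF that] fin_atoms])
  have eh: "e i \<in> h i" if "i \<in> {1..r}" for i
    unfolding he[OF that] by (rule equiv_class_self[OF D_atoms_equiv e[OF that]])
  define n where "n i = card (h i)" for i
  have n: "n i \<ge> 1" if "i \<in> {1..r}" for i
    using eh[OF that] h_fin[OF that] by (auto simp: n_def Suc_le_eq card_gt_0_iff)
  have "\<forall>i\<in>{1..r}. \<exists>b. bij_betw b {0..<n i} (h i)"
    unfolding n_def using ex_bij_betw_nat_finite[OF h_fin] by blast
  then obtain b where b: "\<And>i. i \<in> {1..r} \<Longrightarrow> bij_betw (b i) {0..<n i} (h i)"
    by metis
  have bh: "b i j \<in> h i" if "i \<in> {1..r}" "j < n i" for i j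
    using b[OF that(1)] that(2) by (auto simp: bij_betw_def)
  define x where "x i j = (SOME y. y \<in> carrier S \<and> y\<dagger> \<otimes> y = e i \<and> y \<otimes> y\<dagger> = b i j)" for i j
  have x: "x i j \<in> carrier S \<and> (x i j)\<dagger> \<otimes> x i j = e i \<and> x i j \<otimes> (x i j)\<dagger> = b i j"
    if "i \<in> {1..r}" "j < n i" for i j
  proof -
    have "\<exists>y. y \<in> carrier S \<and> y\<dagger> \<otimes> y = e i \<and> y \<otimes> y\<dagger> = b i j"
      using bh[OF that] unfolding he[OF that(1)] by (auto simp: D_atoms_def)
    then show ?thesis unfolding x_def by (rule someI_ex)
  qed
  have in_block: "\<exists>j<n i. f = x i j \<otimes> (x i j)\<dagger>" if i: "i \<in> {1..r}" and f: "f \<in> h i" for i f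
  proof -
    have "f \<in> b i ` {0..<n i}" using b[OF i] f by (simp add: bij_betw_def)
    then obtain j where "j < n i" "f = b i j" by auto
    then show ?thesis using x[OF i] by auto
  qed
  have "matrix_coordinates S {1..r} n e x"
  proof (intro matrix_coordinates.intro matrix_coordinates_axioms.intro boolean_inverse_monoid_axioms)
    \<comment> \<open>Atoms of different classes differ because classes are disjoint, and inside one class the
      enumeration is injective.\<close>
    fix i j k l
    assume ij: "i \<in> {1..r}" "j < n i" and kl: "k \<in> {1..r}" "l < n k"
      and eq: "x i j \<otimes> (x i j)\<dagger> = x k l \<otimes> (x k l)\<dagger>"
    have eq': "b i j = b k l" using eq x[OF ij] x[OF kl] by simp
    then have "h i \<inter> h k \<noteq> {}" using bh[OF ij] bh[OF kl] by auto
    then have "h i = h k"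
      using quotient_disj[OF D_atoms_equiv, of "h i" "h k"] hQ ij kl unfolding Q_def by blast
    then have "i = k" using h ij kl by (auto simp: bij_betw_def dest: inj_onD)
    moreover have "inj_on (b i) {0..<n i}" using b[OF ij(1)] by (simp add: bij_betw_def)
    ultimately show "i = k \<and> j = l" using eq' ij kl by (auto dest: inj_onD)
  next
    fix f assume f: "f \<in> atoms"
    then have "D_atoms `` {f} \<in> h ` {1..r}"
      using h quotientI[OF f, of D_atoms] by (simp add: bij_betw_def Q_def)
    then obtain i where i: "i \<in> {1..r}" "D_atoms `` {f} = h i" by blast
    then have "f \<in> h i" using equiv_class_self[OF D_atoms_equiv f] by simp
    then show "\<exists>i\<in>{1..r}. \<exists>j<n i. f = x i j \<otimes> (x i j)\<dagger>"
      using in_block i by blast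
  next
    fix i y assume i: "i \<in> {1..r}" and "y \<in> carrier S" "y\<dagger> \<otimes> y = e i"
    then have "y \<otimes> y\<dagger> \<in> h i"
      unfolding he[OF i] using e[OF i] by (auto simp: D_atoms_def)
    then show "\<exists>j<n i. y \<otimes> y\<dagger> = x i j \<otimes> (x i j)\<dagger>" by (rule in_block[OF i])
  qed (use fin e x in auto)
  then show thesis using that r n by blast
qed

end

theorem theorem4p7:
  fixes S :: "('a, 'b) monoid_scheme"
  assumes "boolean_inverse_monoid S"
    and "finite (carrier S)"
  shows "\<exists>(r::nat) (G :: nat \<Rightarrow> 'a monoid) (n :: nat \<Rightarrow> nat).
    r \<ge> 1 \<and>
    (\<forall>i\<in>{1..r}. group (G i) \<and> finite (carrier (G i)) \<and> n i \<ge> 1) \<and>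
    S \<cong> product_group {1..r} (\<lambda>i. rook_matrix_semigroup (n i) (adjoin_zero (G i)))"
proof -
  interpret boolean_inverse_monoid S by (rule assms(1))
  obtain r :: nat and n e x where r: "r \<ge> 1" and C: "matrix_coordinates S {1..r} n e x"
    and n: "\<forall>i\<in>{1..r}. n i \<ge> 1"
    by (rule matrix_coordinates_exist[OF assms(2)])
  interpret C: matrix_coordinates S "{1..r}" n e x by (rule C)
  have fin: "finite (carrier (local_group f))" for f
    by (rule finite_subset[OF _ assms(2)]) (auto simp: local_group_carrier)
  show ?thesis
  proof (intro exI conjI ballI)
    show "S \<cong> product_group {1..r} (\<lambda>i. rook_matrix_semigroup (n i) (adjoin_zero (local_group (e i))))"
      by (rule is_isoI[OF C.coords_iso])
  qed (use r n fin C.group_local in auto)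
qed

end
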